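(* Let $|q|<1$ and $(a,b)$ a pair of coprime integers with $1\leq b<a$. If $a<2b$ then \[ \sum_{m\in\mathbb Z_{\ge0}^d}\frac{q^{\bar m^TCm}}{(q)_{2m_1}}\prod_{j=2}^d\begin{bmatrix}\tau_jm_j+n_j\\ \tau_jm_j\end{bmatrix}=\frac{(q^{ab-1},q^{ab},q^{2ab-1};q^{2ab-1})_\infty}{(q;q)_\infty}. \] If $a>2b$ and $b\ne1$ then \[ \sum_{\substack{n_1,\dots,n_{a_0}\ge0\\ m_{a_0+1},\dots,m_d\ge0}}\frac{q^{\sum_{i=1}^{a_0}(N_i+m_{a_0+1})^2+\sum_{j,k=a_0+1}^d\bar m_jC_{j,k}m_k}}{(q)_{n_1}\cdots(q)_{n_{a_0}}(q)_{2m_{a_0+1}}}\prod_{j=a_0+2}^d\begin{bmatrix}\tau_jm_j+n_j\\ \tau_jm_j\end{bmatrix}=\frac{(q^{ab-1},q^{ab},q^{2ab-1};q^{2ab-1})_\infty}{(q;q)_\infty}. \]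
   Context: Notation: $(x;q)_n=\prod_{i=0}^{n-1}(1-xq^i)$ (also $n=\infty$), $(q)_n=(q;q)_n$, $(x_1,\dots,x_r;q)_\infty=\prod_i(x_i;q)_\infty$; $\begin{bmatrix}n\\ m\end{bmatrix}=\frac{(q)_n}{(q)_m(q)_{n-m}}$ if $m,n-m$ are nonnegative integers, $0$ otherwise. Continued-fraction data: for coprime $1\le b<a$ with $a\ne 2b$ let $\mathrm{cf}(a,b)=(a/b-1)^{s}$ with $s=1$ if $a>2b$, $s=-1$ if $a<2b$. Write $\mathrm{cf}(a,b)=[a_0,\dots,a_n]$ (regular continued fraction with positive integer partial quotients) with $a_n\ge 2$. Put $t_0=0$, $t_j=a_0+\dots+a_{j-1}$ ($1\le j\le n+1$), $d=t_{n+1}$. $\mathcal I$ is the $d\times d$ matrix with $\mathcal I_{j,k}=\delta_{j,k+1}+\delta_{j,k-1}$ if $j\notin\{t_1,\dots,t_{n+1}\}$ and $\delta_{j,k+1}+\delta_{j,k}-\delta_{j,k-1}$ otherwise; $C=2I-\mathcal I$. $\tau_j=2$ for $j<d$, $\tau_d=1$. $\bar m_j=m_j$ for $j<d$ and $\bar m_d=0$; $\bar m^TCm=\sum_{j,k}\bar m_jC_{j,k}m_k$. In the case $a<2b$, $n_j=-\sum_{k=1}^dC_{j,k}m_k$ for $j\ge2$. In the case $a>2b$: $N_i=n_i+\dots+n_{a_0}$, and $n_j=-\sum_{k=a_0+1}^dC_{j,k}m_k$ for $j\ge a_0+2$. *)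

theory Defs
  imports "HOL-Analysis.Analysis"
begin

definition qpoch :: "complex \<Rightarrow> complex \<Rightarrow> nat \<Rightarrow> complex" where
  "qpoch x q n = (\<Prod>i<n. 1 - x * q ^ i)"

definition qpoch_inf :: "complex \<Rightarrow> complex \<Rightarrow> complex" where
  "qpoch_inf x q = (\<Prod>i. 1 - x * q ^ i)"

definition qbinom :: "complex \<Rightarrow> int \<Rightarrow> int \<Rightarrow> complex" where
  "qbinom q n m = (if 0 \<le> m \<and> 0 \<le> n - m
      then qpoch q q (nat n) / (qpoch q q (nat m) * qpoch q q (nat (n - m))) else 0)"

fun cfval :: "nat list \<Rightarrow> rat" where
  "cfval [] = 0"
| "cfval [x] = of_nat x"
| "cfval (x # y # ys) = of_nat x + 1 / cfval (y # ys)"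

definition cf :: "nat \<Rightarrow> nat \<Rightarrow> rat" where
  "cf a b = (if a > 2 * b then of_nat a / of_nat b - 1 else inverse (of_nat a / of_nat b - 1))"

definition is_cf_expansion :: "nat \<Rightarrow> nat \<Rightarrow> nat list \<Rightarrow> bool" where
  "is_cf_expansion a b as \<longleftrightarrow> as \<noteq> [] \<and> (\<forall>x\<in>set as. 1 \<le> x) \<and> 2 \<le> last as
      \<and> cfval as = cf a b"

definition tt :: "nat list \<Rightarrow> nat \<Rightarrow> nat" where
  "tt as j = sum_list (take j as)"

definition dd :: "nat list \<Rightarrow> nat" where
  "dd as = sum_list as"

definition Tset :: "nat list \<Rightarrow> nat set" where
  "Tset as = {tt as j | j. 1 \<le> j \<and> j \<le> length as}"

definition delta :: "nat \<Rightarrow> nat \<Rightarrow> int" where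
  "delta j k = (if j = k then 1 else 0)"

text \<open>The matrix I (indices 1..d); delta_(j,k-1) is written as delta (j+1) k.\<close>
definition Imat :: "nat list \<Rightarrow> nat \<Rightarrow> nat \<Rightarrow> int" where
  "Imat as j k = (if j \<notin> Tset as then delta j (k + 1) + delta (j + 1) k
                  else delta j (k + 1) + delta j k - delta (j + 1) k)"

definition Cmat :: "nat list \<Rightarrow> nat \<Rightarrow> nat \<Rightarrow> int" where
  "Cmat as j k = 2 * delta j k - Imat as j k"

definition tau :: "nat list \<Rightarrow> nat \<Rightarrow> int" where
  "tau as j = (if j < dd as then 2 else 1)"

definition mbar :: "nat list \<Rightarrow> (nat \<Rightarrow> nat) \<Rightarrow> nat \<Rightarrow> int" where
  "mbar as m j = (if j < dd as then int (m j) else 0)"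

definition quadC :: "nat list \<Rightarrow> (nat \<Rightarrow> nat) \<Rightarrow> int" where
  "quadC as m = (\<Sum>j\<in>{1..dd as}. \<Sum>k\<in>{1..dd as}. mbar as m j * Cmat as j k * int (m k))"

definition nvec1 :: "nat list \<Rightarrow> (nat \<Rightarrow> nat) \<Rightarrow> nat \<Rightarrow> int" where
  "nvec1 as m j = - (\<Sum>k\<in>{1..dd as}. Cmat as j k * int (m k))"

definition summand1 :: "complex \<Rightarrow> nat list \<Rightarrow> (nat \<Rightarrow> nat) \<Rightarrow> complex" where
  "summand1 q as m = q powi (quadC as m) / qpoch q q (2 * m 1)
     * (\<Prod>j\<in>{2..dd as}. qbinom q (tau as j * int (m j) + nvec1 as m j) (tau as j * int (m j)))"

definition nvec2 :: "nat list \<Rightarrow> (nat \<Rightarrow> nat) \<Rightarrow> nat \<Rightarrow> int" where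
  "nvec2 as m j = - (\<Sum>k\<in>{hd as + 1..dd as}. Cmat as j k * int (m k))"

definition NN :: "nat list \<Rightarrow> (nat \<Rightarrow> nat) \<Rightarrow> nat \<Rightarrow> int" where
  "NN as n i = (\<Sum>l\<in>{i..hd as}. int (n l))"

definition expo2 :: "nat list \<Rightarrow> (nat \<Rightarrow> nat) \<Rightarrow> (nat \<Rightarrow> nat) \<Rightarrow> int" where
  "expo2 as n m = (\<Sum>i\<in>{1..hd as}. (NN as n i + int (m (hd as + 1)))\<^sup>2)
     + (\<Sum>j\<in>{hd as + 1..dd as}. \<Sum>k\<in>{hd as + 1..dd as}. mbar as m j * Cmat as j k * int (m k))"

definition summand2 :: "complex \<Rightarrow> nat list \<Rightarrow> (nat \<Rightarrow> nat) \<Rightarrow> (nat \<Rightarrow> nat) \<Rightarrow> complex" where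
  "summand2 q as n m = q powi (expo2 as n m)
     / ((\<Prod>i\<in>{1..hd as}. qpoch q q (n i)) * qpoch q q (2 * m (hd as + 1)))
     * (\<Prod>j\<in>{hd as + 2..dd as}. qbinom q (tau as j * int (m j) + nvec2 as m j) (tau as j * int (m j)))"

definition rhs :: "complex \<Rightarrow> nat \<Rightarrow> nat \<Rightarrow> complex" where
  "rhs q a b = qpoch_inf (q ^ (a * b - 1)) (q ^ (2 * a * b - 1))
     * qpoch_inf (q ^ (a * b)) (q ^ (2 * a * b - 1))
     * qpoch_inf (q ^ (2 * a * b - 1)) (q ^ (2 * a * b - 1)) / qpoch_inf q q"

end

theory Submission
  imports Defs
begin

text \<open>
  Write B(L,M,a,b) = [L+M+a-b; L+a] [L+M-a+b; L-a]. The q-Saalschuetz sum yields Burge's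
  transformation: summing q^(i^2) [2L+M-i; 2L] B(L-i,i,a,b) over i gives q^(b^2) B(L,M,a+b,b), and
  since B(L,M,a,b) = B(M,L,b,a), replacing B(L-i,i,a,b) by B(i,L-i,a,b) gives q^(a^2) B(L,M,a+b,a).
  On the ratio a/b these two steps act as x -> 1 + x and x -> 1 + 1/x, so a continued fraction
  prescribes a succession of steps; the rows of C in Tset are those where L and M are interchanged.
  Starting from the identity sum_j (-1)^j q^(j(j-1)/2) B(L,M,j,j) = q^(LM) [L+M; L], one reaches a
  finite multisum equal to sum_j (-1)^j q^(j(j-1)/2 + (ab-1)j^2) B(L,M,aj,bj). Letting M tend to
  infinity gives a Bailey pair, Bailey's lemma brings in the variables n_1, n_2, ..., and letting L
  tend to infinity leaves a theta series, which the Jacobi triple product turns into the right-hand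
  side. Absolute convergence comes for free: every term is bounded by the same term at |q|, and
  there the nonnegative inner sums are evaluated by the same finite identity.
\<close>

section \<open>Sums of Gaussian binomial coefficients\<close>

text \<open>The exponent a*b - 1 comes from an invariant. A pair (x, y) always occurs together with
  the factor q^((x*y - 1) j^2). A Burge step with parameters (x j, y j) multiplies the j-th term by
  q^((y j)^2) and leads to the pair (x + y, y), and x*y - 1 + y^2 = (x + y)*y - 1; the other step is
  the same with x and y exchanged. The start (1, 1) has exponent 0. A Bailey step keeps the pair and
  adds x^2; the passage L -> infinity counts as one more such step, which brings the total to a*b -
  1.

  The multisum has infinitely many index tuples, but its binomials vanish unless the m_j decrease
  weakly, and the numbers N_i + m_(a_0+1) prolong this to a single decreasing sequence. For a fixed
  largest entry only finitely many terms remain. So the finite identities evaluate everything below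
  that entry, and convergence concerns one variable only.\<close>

definition qfac :: "'a::field \<Rightarrow> nat \<Rightarrow> 'a" where
  "qfac q n = (\<Prod>i<n. 1 - q ^ Suc i)"

definition gbinom :: "'a::field \<Rightarrow> nat \<Rightarrow> nat \<Rightarrow> 'a" where
  "gbinom q n k = (if k \<le> n then qfac q n / (qfac q k * qfac q (n - k)) else 0)"

text \<open>Under this condition every \<open>qfac q n\<close> is nonzero, so the division in
  \<open>gbinom\<close> is genuine. It holds for every q of norm below 1, including 0, in the real
  as well as in the complex field; the finite identities are needed both at q and at |q|.\<close>

definition no_root_of_unity :: "'a::field \<Rightarrow> bool" where
  "no_root_of_unity q \<longleftrightarrow> (\<forall>n>0. q ^ n \<noteq> 1)"

lemma qfac_0 [simp]: "qfac q 0 = 1"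
  by (simp add: qfac_def)

lemma qfac_Suc: "qfac q (Suc n) = qfac q n * (1 - q ^ Suc n)"
  by (simp add: qfac_def)

lemma qfac_nonzero: "no_root_of_unity q \<Longrightarrow> qfac q n \<noteq> 0"
  unfolding qfac_def no_root_of_unity_def by (auto simp del: power_Suc)

lemma gbinom_0_right: "no_root_of_unity q \<Longrightarrow> gbinom q n 0 = 1"
  by (simp add: gbinom_def qfac_nonzero)

lemma gbinom_0_left: "gbinom q 0 k = (if k = 0 then 1 else 0)"
  by (simp add: gbinom_def)

lemma gbinom_eq_0: "n < k \<Longrightarrow> gbinom q n k = 0"
  by (simp add: gbinom_def)

lemma gbinom_sym: "k \<le> n \<Longrightarrow> gbinom q n (n - k) = gbinom q n k"
  by (simp add: gbinom_def mult.commute)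

lemma gbinom_Suc_Suc:
  assumes "no_root_of_unity q"
  shows "gbinom q (Suc n) (Suc k) = gbinom q n (Suc k) + q ^ (n - k) * gbinom q n k"
proof -
  consider "n < k" | "n = k" | m where "n = Suc (k + m)"
    by (metis less_imp_Suc_add nat_neq_iff)
  then show ?thesis
  proof cases
    case (3 m)
    have nz: "qfac q j \<noteq> 0" for j using qfac_nonzero[OF assms] .
    have ne: "1 - q ^ Suc j \<noteq> 0" for j
      using assms unfolding no_root_of_unity_def by (metis eq_iff_diff_eq_0 zero_less_Suc)
    have 1: "gbinom q (Suc n) (Suc k) = qfac q n * (1 - q ^ Suc n) / (qfac q k * (1 - q ^ Suc k) * (qfac q m * (1 - q ^ Suc m)))"
      using 3 by (simp add: gbinom_def qfac_Suc del: power_Suc)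
    have 2: "gbinom q n (Suc k) = qfac q n / (qfac q k * (1 - q ^ Suc k) * qfac q m)"
      using 3 by (simp add: gbinom_def qfac_Suc del: power_Suc)
    have 4: "gbinom q n k = qfac q n / (qfac q k * (qfac q m * (1 - q ^ Suc m)))"
      using 3 by (simp add: gbinom_def qfac_Suc Suc_diff_le del: power_Suc)
    have "(1 - q ^ Suc n) = (1 - q ^ Suc m) + q ^ Suc m * (1 - q ^ Suc k)"
      using 3 by (simp add: algebra_simps flip: power_add)
    then show ?thesis
      unfolding 1 2 4 using nz ne[of k] ne[of m] 3
      by (simp add: divide_simps del: power_Suc) (simp add: algebra_simps power_add)
  qed (simp_all add: gbinom_def qfac_nonzero assms)
qed

lemma gbinom_Suc_Suc':
  assumes "no_root_of_unity q"
  shows "gbinom q (Suc n) (Suc k) = q ^ Suc k * gbinom q n (Suc k) + gbinom q n k"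
proof (cases "k < n")
  case True
  have "gbinom q (Suc n) (Suc k) = gbinom q (Suc n) (Suc (n - Suc k))"
    using gbinom_sym[of "Suc k" "Suc n" q] True by (simp add: Suc_diff_Suc)
  also have "\<dots> = gbinom q n (n - k) + q ^ Suc k * gbinom q n (n - Suc k)"
    using gbinom_Suc_Suc[OF assms, of n "n - Suc k"] True by (simp add: Suc_diff_Suc)
  finally show ?thesis using True gbinom_sym[of k n q] gbinom_sym[of "Suc k" n q] by simp
qed (auto simp: gbinom_def qfac_nonzero assms)

text \<open>Induction on A by Pascal's rule. The truncated subtraction in the exponent is harmless:
  if B + k < N, then N - k > B and the second binomial vanishes.\<close>

lemma q_Vandermonde:
  assumes "no_root_of_unity q"
  shows "(\<Sum>k\<le>N. q ^ (k * (B + k - N)) * gbinom q A k * gbinom q B (N - k)) = gbinom q (A + B) N"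
proof (induction A arbitrary: N)
  case 0
  have "(\<Sum>k\<le>N. q ^ (k * (B + k - N)) * gbinom q 0 k * gbinom q B (N - k))
      = (\<Sum>k\<in>{0}. q ^ (k * (B + k - N)) * gbinom q 0 k * gbinom q B (N - k))"
    by (rule sum.mono_neutral_right) (auto simp: gbinom_0_left)
  then show ?case by (simp add: gbinom_0_left)
next
  case (Suc A)
  show ?case
  proof (cases N)
    case 0
    then show ?thesis by (simp add: gbinom_0_right assms)
  next
    case (Suc N')
    have tm: "q ^ (Suc k * (B + Suc k - Suc N')) * gbinom q (Suc A) (Suc k) * gbinom q B (N' - k)
       = q ^ (Suc k * (B + Suc k - Suc N')) * gbinom q A (Suc k) * gbinom q B (N' - k)
        + q ^ (A + B - N') * (q ^ (k * (B + k - N')) * gbinom q A k * gbinom q B (N' - k))" if "k \<le> N'" for k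
    proof (cases "k \<le> A \<and> N' - k \<le> B")
      case True
      then obtain u v where "A = k + u" "B + k = N' + v"
        by (metis le_add_diff_inverse le_diff_conv)
      then have e: "Suc k * (B + k - N') + (A - k) = (A + B - N') + k * (B + k - N')" by simp
      have "q ^ (Suc k * (B + Suc k - Suc N')) * (q ^ (A - k) * gbinom q A k) * gbinom q B (N' - k)
        = q ^ (Suc k * (B + k - N') + (A - k)) * gbinom q A k * gbinom q B (N' - k)"
        by (simp add: power_add mult_ac)
      then show ?thesis unfolding gbinom_Suc_Suc[OF assms] e by (simp add: algebra_simps power_add)
    next
      case False
      then show ?thesis unfolding gbinom_Suc_Suc[OF assms] by (auto simp: gbinom_eq_0)
    qed
    have "(\<Sum>k\<le>N. q ^ (k * (B + k - N)) * gbinom q (Suc A) k * gbinom q B (N - k)) =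
      gbinom q B N + (\<Sum>k\<le>N'. q ^ (Suc k * (B + Suc k - Suc N')) * gbinom q (Suc A) (Suc k) * gbinom q B (N' - k))"
      unfolding Suc by (subst sum.atMost_Suc_shift) (simp add: gbinom_0_right assms)
    also have "(\<Sum>k\<le>N'. q ^ (Suc k * (B + Suc k - Suc N')) * gbinom q (Suc A) (Suc k) * gbinom q B (N' - k))
       = (\<Sum>k\<le>N'. q ^ (Suc k * (B + Suc k - Suc N')) * gbinom q A (Suc k) * gbinom q B (N' - k))
        + q ^ (A + B - N') * gbinom q (A + B) N'"
      by (subst sum.cong[OF refl tm]) (simp_all add: sum.distrib Suc.IH flip: sum_distrib_left)
    also have "gbinom q B N + ((\<Sum>k\<le>N'. q ^ (Suc k * (B + Suc k - Suc N')) * gbinom q A (Suc k) * gbinom q B (N' - k))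
        + q ^ (A + B - N') * gbinom q (A + B) N')
      = (\<Sum>k\<le>N. q ^ (k * (B + k - N)) * gbinom q A k * gbinom q B (N - k)) + q ^ (A + B - N') * gbinom q (A + B) N'"
      unfolding Suc by (subst sum.atMost_Suc_shift) (simp add: gbinom_0_right assms)
    finally show ?thesis by (simp add: Suc.IH Suc gbinom_Suc_Suc[OF assms])
  qed
qed

text \<open>The mirror image of \<open>q_Vandermonde\<close> under k -> N - k with A and B
  exchanged. The induction is again on A, now with the other Pascal rule; for k > A the first
  binomial vanishes, so truncation does no harm.\<close>

lemma q_Vandermonde':
  assumes "no_root_of_unity q"
  shows "(\<Sum>k\<le>N. q ^ ((A - k) * (N - k)) * gbinom q A k * gbinom q B (N - k)) = gbinom q (A + B) N"
proof (induction A arbitrary: N)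
  case 0
  have "(\<Sum>k\<le>N. q ^ ((0 - k) * (N - k)) * gbinom q 0 k * gbinom q B (N - k))
      = (\<Sum>k\<in>{0}. q ^ ((0 - k) * (N - k)) * gbinom q 0 k * gbinom q B (N - k))"
    by (rule sum.mono_neutral_right) (auto simp: gbinom_0_left)
  then show ?case by (simp add: gbinom_0_left)
next
  case (Suc A)
  show ?case
  proof (cases N)
    case 0
    then show ?thesis by (simp add: gbinom_0_right assms)
  next
    case (Suc N')
    have tm: "q ^ ((Suc A - Suc k) * (Suc N' - Suc k)) * gbinom q (Suc A) (Suc k) * gbinom q B (Suc N' - Suc k)
       = q ^ Suc N' * (q ^ ((A - Suc k) * (Suc N' - Suc k)) * gbinom q A (Suc k) * gbinom q B (Suc N' - Suc k))
        + (q ^ ((A - k) * (N' - k)) * gbinom q A k * gbinom q B (N' - k))" if "k \<le> N'" for k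
    proof (cases "Suc k \<le> A")
      case True
      with that obtain u v where "A = Suc k + u" "N' = k + v"
        by (metis le_add_diff_inverse)
      then have e: "(A - k) * (N' - k) + Suc k = Suc N' + (A - Suc k) * (N' - k)" by simp
      have "q ^ ((A - k) * (N' - k)) * (q ^ Suc k * gbinom q A (Suc k)) * gbinom q B (N' - k)
        = q ^ ((A - k) * (N' - k) + Suc k) * gbinom q A (Suc k) * gbinom q B (N' - k)"
        by (simp only: power_add mult_ac)
      then show ?thesis unfolding gbinom_Suc_Suc'[OF assms] e diff_Suc_Suc
        by (simp only: distrib_left distrib_right power_add mult_ac)
    next
      case False
      then show ?thesis unfolding gbinom_Suc_Suc'[OF assms] by (auto simp: gbinom_eq_0)
    qed
    have "(\<Sum>k\<le>N. q ^ ((Suc A - k) * (N - k)) * gbinom q (Suc A) k * gbinom q B (N - k)) =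
      q ^ (Suc A * Suc N') * gbinom q B N + (\<Sum>k\<le>N'. q ^ ((Suc A - Suc k) * (Suc N' - Suc k)) * gbinom q (Suc A) (Suc k) * gbinom q B (Suc N' - Suc k))"
      unfolding Suc by (subst sum.atMost_Suc_shift) (simp only: gbinom_0_right assms diff_zero mult_1_right)
    also have "(\<Sum>k\<le>N'. q ^ ((Suc A - Suc k) * (Suc N' - Suc k)) * gbinom q (Suc A) (Suc k) * gbinom q B (Suc N' - Suc k))
       = q ^ Suc N' * (\<Sum>k\<le>N'. q ^ ((A - Suc k) * (Suc N' - Suc k)) * gbinom q A (Suc k) * gbinom q B (Suc N' - Suc k))
        + gbinom q (A + B) N'"
      by (subst sum.cong[OF refl tm]) (simp_all only: sum.distrib Suc.IH sum_distrib_left atMost_iff)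
    also have "q ^ (Suc A * Suc N') * gbinom q B N + (q ^ Suc N' * (\<Sum>k\<le>N'. q ^ ((A - Suc k) * (Suc N' - Suc k)) * gbinom q A (Suc k) * gbinom q B (Suc N' - Suc k))
        + gbinom q (A + B) N')
      = q ^ Suc N' * (\<Sum>k\<le>N. q ^ ((A - k) * (N - k)) * gbinom q A k * gbinom q B (N - k)) + gbinom q (A + B) N'"
    proof -
      have "q ^ (Suc A * Suc N') * gbinom q B N = q ^ Suc N' * (q ^ ((A - 0) * (N - 0)) * gbinom q A 0 * gbinom q B (N - 0))"
        by (simp add: Suc gbinom_0_right assms power_add)
      then show ?thesis unfolding Suc sum.atMost_Suc_shift by (simp only: distrib_left add.assoc)
    qed
    finally show ?thesis by (simp only: Suc.IH Suc gbinom_Suc_Suc'[OF assms] add_Suc)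
  qed
qed

lemma gbinom_mult_gbinom:
  assumes "no_root_of_unity q" "k \<le> l"
  shows "gbinom q x k * gbinom q (x - k) (l - k) = gbinom q x l * gbinom q l k"
  using assms by (auto simp: gbinom_def qfac_nonzero)

lemma sum_triangle:
  fixes g :: "nat \<Rightarrow> nat \<Rightarrow> 'b::comm_monoid_add"
  shows "(\<Sum>k\<le>n. \<Sum>j\<le>n - k. g k j) = (\<Sum>l\<le>n. \<Sum>k\<le>l. g k (l - k))"
proof -
  have "(\<Sum>k\<le>n. \<Sum>j\<le>n - k. g k j) = (\<Sum>(k, j)\<in>Sigma {..n} (\<lambda>k. {..n - k}). g k j)"
    by (rule sum.Sigma) auto
  also have "\<dots> = (\<Sum>(l, k)\<in>Sigma {..n} (\<lambda>l. {..l}). g k (l - k))"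
    by (rule sum.reindex_bij_witness[of _ "\<lambda>(l, k). (k, l - k)" "\<lambda>(k, j). (k + j, k)"]) auto
  also have "\<dots> = (\<Sum>l\<le>n. \<Sum>k\<le>l. g k (l - k))"
    by (rule sum.Sigma[symmetric]) auto
  finally show ?thesis .
qed

text \<open>Expand the last factor by q-Vandermonde: the sum over k for fixed l = k + j and the remaining sum
  over l are again of Vandermonde type.\<close>

lemma q_Saalschuetz:
  assumes "no_root_of_unity q"
  shows "(\<Sum>k\<le>n. q ^ (k * (k + c)) * gbinom q x k * gbinom q y (k + c) * gbinom q (x + y + n - k) (x + y))
    = gbinom q (x + n + c) n * gbinom q (y + n) (n + c)"
proof (cases "c \<le> y")
  case False
  then show ?thesis by (simp add: gbinom_eq_0)
next
  case True
  let ?g = "\<lambda>k j. q ^ (k * (k + c)) * gbinom q x k * gbinom q y (k + c) *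
      (q ^ (j * (y + k + j)) * gbinom q (x - k) j * gbinom q (y + n) (n - k - j))"
  have 1: "q ^ (k * (k + c)) * gbinom q x k * gbinom q y (k + c) * gbinom q (x + y + n - k) (x + y)
     = (\<Sum>j\<le>n - k. ?g k j)" if "k \<le> n" for k
  proof (cases "k \<le> x")
    case False
    then show ?thesis by (simp add: gbinom_eq_0)
  next
    case kx: True
    have "gbinom q (x + y + n - k) (x + y) = gbinom q ((x - k) + (y + n)) (n - k)"
      using gbinom_sym[of "n - k" "x + y + n - k" q] that kx by (simp add: add_ac)
    also have "\<dots> = (\<Sum>j\<le>n - k. q ^ (j * (y + n + j - (n - k))) * gbinom q (x - k) j * gbinom q (y + n) (n - k - j))"
      using q_Vandermonde[OF assms, where N = "n - k" and B = "y + n" and A = "x - k"] by simp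
    also have "\<dots> = (\<Sum>j\<le>n - k. q ^ (j * (y + k + j)) * gbinom q (x - k) j * gbinom q (y + n) (n - k - j))"
      using that by (intro sum.cong) (auto simp: add_ac)
    finally show ?thesis by (simp add: sum_distrib_left)
  qed
  have 2: "(\<Sum>k\<le>l. ?g k (l - k)) = q ^ (l * (l + c)) * gbinom q x l * gbinom q (y + n) (n - l) * gbinom q (l + y) (y - c)" for l
  proof -
    \<comment> \<open>The guard \<open>k \<le> y - c\<close> cannot be dropped: beyond it
      \<open>gbinom q y (k + c)\<close> vanishes, whereas in the mirrored form
      \<open>y - c - k\<close> truncates to 0 and the binomial would be 1.\<close>
    have a: "?g k (l - k) = q ^ (l * (l + c)) * gbinom q x l * gbinom q (y + n) (n - l) *
       (if k \<le> y - c then q ^ ((l - k) * (y - c - k)) * gbinom q l k * gbinom q y (y - c - k) else 0)" if "k \<le> l" for k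
    proof (cases "k + c \<le> y")
      case False
      then have "gbinom q y (k + c) = 0" "\<not> k \<le> y - c" using True by (auto simp: gbinom_eq_0)
      then show ?thesis by (simp only: mult_zero_right mult_zero_left if_False)
    next
      case kc: True
      with that obtain u v where uv: "l = k + u" "y = k + c + v"
        by (metis le_add_diff_inverse)
      have e: "q ^ (k * (k + c)) * q ^ ((l - k) * (y + k + (l - k))) = q ^ (l * (l + c)) * q ^ ((l - k) * (y - c - k))"
        unfolding uv power_add[symmetric] by (simp add: algebra_simps)
      have s: "gbinom q y (y - c - k) = gbinom q y (k + c)"
        using gbinom_sym[of "k + c" y q] kc by (simp add: add.commute diff_diff_left)
      have "?g k (l - k) = (q ^ (k * (k + c)) * q ^ ((l - k) * (y + k + (l - k)))) * (gbinom q x k * gbinom q (x - k) (l - k))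
         * gbinom q y (k + c) * gbinom q (y + n) (n - l)"
        using that by (simp add: mult_ac)
      then show ?thesis unfolding e gbinom_mult_gbinom[OF assms that] s using kc by (simp add: mult_ac)
    qed
    have "(\<Sum>k\<le>l. ?g k (l - k)) = q ^ (l * (l + c)) * gbinom q x l * gbinom q (y + n) (n - l) *
       (\<Sum>k\<le>l. if k \<le> y - c then q ^ ((l - k) * (y - c - k)) * gbinom q l k * gbinom q y (y - c - k) else 0)"
      unfolding sum_distrib_left by (intro sum.cong refl a) simp
    also have "(\<Sum>k\<le>l. if k \<le> y - c then q ^ ((l - k) * (y - c - k)) * gbinom q l k * gbinom q y (y - c - k) else 0) = (\<Sum>k\<le>y - c. q ^ ((l - k) * (y - c - k)) * gbinom q l k * gbinom q y (y - c - k))"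
      by (rule sum.mono_neutral_cong) (auto simp: gbinom_eq_0)
    also have "\<dots> = gbinom q (l + y) (y - c)" by (rule q_Vandermonde'[OF assms])
    finally show ?thesis .
  qed
  \<comment> \<open>Both products equal (q)_(y+n) / ((q)_(n-l) (q)_(y-c) (q)_(l+c)). The new form
    has a factor free of l, and what is left under the sum is \<open>q_Vandermonde\<close> for x and
    n + c.\<close>
  have 3: "gbinom q (y + n) (n - l) * gbinom q (l + y) (y - c) = gbinom q (y + n) (n + c) * gbinom q (n + c) (n - l)" if "l \<le> n" for l
  proof -
    have "n - l \<le> n + c" "n - l \<le> y + n" "y - c \<le> l + y" "n + c \<le> y + n" "y + n - (n - l) = l + y"
      "l + y - (y - c) = l + c" "y + n - (n + c) = y - c" "n + c - (n - l) = l + c"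
      using True that by auto
    then show ?thesis by (simp add: gbinom_def qfac_nonzero assms add.commute[of y l])
  qed
  have "(\<Sum>k\<le>n. q ^ (k * (k + c)) * gbinom q x k * gbinom q y (k + c) * gbinom q (x + y + n - k) (x + y))
     = (\<Sum>k\<le>n. \<Sum>j\<le>n - k. ?g k j)"
    by (intro sum.cong refl 1) simp
  also have "\<dots> = (\<Sum>l\<le>n. \<Sum>k\<le>l. ?g k (l - k))"
    by (rule sum_triangle)
  also have "\<dots> = gbinom q (y + n) (n + c) * (\<Sum>l\<le>n. q ^ (l * (n + c + l - n)) * gbinom q x l * gbinom q (n + c) (n - l))"
    unfolding sum_distrib_left 2
  proof (intro sum.cong refl)
    fix l assume "l \<in> {..n}"
    then have "gbinom q (y + n) (n - l) * gbinom q (l + y) (y - c) = gbinom q (y + n) (n + c) * gbinom q (n + c) (n - l)"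
      by (simp add: 3)
    moreover have "n + c + l - n = l + c" by simp
    ultimately show "q ^ (l * (l + c)) * gbinom q x l * gbinom q (y + n) (n - l) * gbinom q (l + y) (y - c)
      = gbinom q (y + n) (n + c) * (q ^ (l * (n + c + l - n)) * gbinom q x l * gbinom q (n + c) (n - l))"
      by (simp only: mult.assoc) (simp only: mult.left_commute)
  qed
  finally show ?thesis unfolding q_Vandermonde[OF assms] by (simp add: mult_ac add_ac)
qed

section \<open>Burge's transformation\<close>

text \<open>Lower indices such as L - a take either sign. The value 0 outside the natural range lets
  sums over j run over any sufficiently large interval.\<close>

definition gbinom_int :: "'a::field \<Rightarrow> int \<Rightarrow> int \<Rightarrow> 'a" where
  "gbinom_int q n m = (if 0 \<le> m \<and> m \<le> n then gbinom q (nat n) (nat m) else 0)"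

definition Burge :: "'a::field \<Rightarrow> int \<Rightarrow> int \<Rightarrow> int \<Rightarrow> int \<Rightarrow> 'a" where
  "Burge q L M a b = gbinom_int q (L + M + a - b) (L + a) * gbinom_int q (L + M - a + b) (L - a)"

lemma gbinom_int_of_nat: "gbinom_int q (int n) (int k) = gbinom q n k"
  by (auto simp: gbinom_int_def gbinom_eq_0)

lemma gbinom_int_eq_0: "m < 0 \<or> n < m \<Longrightarrow> gbinom_int q n m = 0"
  by (auto simp: gbinom_int_def)

lemma gbinom_int_sym: "gbinom_int q n (n - m) = gbinom_int q n m"
proof (cases "0 \<le> m \<and> m \<le> n")
  case True
  then have "nat (n - m) = nat n - nat m" by (simp add: nat_diff_distrib)
  then show ?thesis using True gbinom_sym[of "nat m" "nat n" q] nat_mono[of m n] by (simp add: gbinom_int_def)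
qed (auto simp: gbinom_int_def)

lemma gbinom_int_sym': "m + k = n \<Longrightarrow> gbinom_int q n m = gbinom_int q n k"
  using gbinom_int_sym[of q n m] by (metis add_diff_cancel_left')

lemma Burge_uminus: "Burge q L M (- a) (- b) = Burge q L M a b"
  by (simp add: Burge_def mult.commute)

lemma Burge_swap: "Burge q L M a b = Burge q M L b a"
proof -
  have 1: "gbinom_int q (L + M + a - b) (L + a) = gbinom_int q (M + L - b + a) (M - b)"
    using gbinom_int_sym'[of "L + a" "M - b" "L + M + a - b" q] by (simp add: algebra_simps)
  have 2: "gbinom_int q (L + M - a + b) (L - a) = gbinom_int q (M + L + b - a) (M + b)"
    using gbinom_int_sym'[of "L - a" "M + b" "L + M - a + b" q] by (simp add: algebra_simps)
  show ?thesis unfolding Burge_def 1 2 by (rule mult.commute)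
qed

lemma gbinom_int_Pascal:
  assumes "no_root_of_unity q" "0 \<le> n"
  shows "gbinom_int q (n + 1) k = gbinom_int q n k + q ^ nat (n + 1 - k) * gbinom_int q n (k - 1)"
proof (cases "0 < k \<and> k \<le> n + 1")
  case True
  then have "nat k = Suc (nat (k - 1))" "nat (n + 1) = Suc (nat n)" "nat (n + 1 - k) = nat n - nat (k - 1)"
    using assms(2) by auto
  then show ?thesis
    using True gbinom_Suc_Suc[OF assms(1), of "nat n" "nat (k - 1)"] by (auto simp: gbinom_int_def gbinom_eq_0)
qed (use assms in \<open>auto simp: gbinom_int_def gbinom_0_right\<close>)

lemma gbinom_int_Pascal':
  assumes "no_root_of_unity q" "0 \<le> n"
  shows "gbinom_int q (n + 1) k = q ^ nat k * gbinom_int q n k + gbinom_int q n (k - 1)"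
proof -
  have "gbinom_int q (n + 1) k = gbinom_int q (n + 1) (n + 1 - k)" by (rule gbinom_int_sym[symmetric])
  also have "\<dots> = gbinom_int q n (n + 1 - k) + q ^ nat k * gbinom_int q n (n - k)"
    using gbinom_int_Pascal[OF assms, of "n + 1 - k"] by simp
  also have "gbinom_int q n (n + 1 - k) = gbinom_int q n (k - 1)"
    by (rule gbinom_int_sym') simp
  finally show ?thesis by (simp add: gbinom_int_sym)
qed

text \<open>Write a = A, b = B, L = A + B + t, M = B + n. Only the terms i = B + k with k at most t
  and n survive, and they form \<open>q_Saalschuetz\<close> with x = 2A + t, y = 2B + t, c = 2B. If
  L < A + B or M < B, both sides vanish.\<close>

lemma Burge_transform:
  fixes L M :: nat and a b :: int
  assumes q: "no_root_of_unity q" and "0 \<le> a" "0 \<le> b"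
  shows "(\<Sum>i\<le>L. q ^ i\<^sup>2 * gbinom_int q (2 * L + M - i) (2 * L) * Burge q (L - i) i a b)
    = q ^ (nat b)\<^sup>2 * Burge q L M (a + b) b"
proof -
  obtain A B where slope: "a = int A" "b = int B" using assms by (metis nonneg_int_cases)
  show ?thesis
  proof (cases "L < A + B \<or> M < B")
    case True
    have "q ^ i\<^sup>2 * gbinom_int q (2 * L + M - i) (2 * L) * Burge q (L - i) i a b = 0" if "i \<le> L" for i
    proof -
      have "int M < i \<or> i < int B \<or> int L - int i - int A < 0"
        using True that by auto
      then show ?thesis using that unfolding slope Burge_def by (auto simp: gbinom_int_eq_0)
    qed
    then have "(\<Sum>i\<le>L. q ^ i\<^sup>2 * gbinom_int q (2 * L + M - i) (2 * L) * Burge q (L - i) i a b) = 0"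
      by (intro sum.neutral) simp
    moreover have "Burge q L M (a + b) b = 0"
      using True unfolding slope Burge_def by (auto simp: gbinom_int_eq_0)
    ultimately show ?thesis by simp
  next
    case False
    then obtain t n where LM: "L = A + B + t" "M = B + n"
      by (auto simp: not_less le_iff_add)
    let ?T = "\<lambda>i. q ^ i\<^sup>2 * gbinom_int q (2 * L + M - i) (2 * L) * Burge q (L - i) i a b"
    let ?S = "\<lambda>k. q ^ (k * (k + 2 * B)) * gbinom q (2 * A + t) k * gbinom q (2 * B + t) (k + 2 * B)
        * gbinom q (2 * A + t + (2 * B + t) + n - k) (2 * A + t + (2 * B + t))"
    have z: "?T i = 0" if "i \<notin> (+) B ` {..min t n}" "i \<le> L" for i
    proof -
      have "i < B \<or> i > B + t \<or> i > B + n"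
      proof (rule ccontr)
        assume "\<not> ?thesis"
        then have "i = B + (i - B) \<and> i - B \<in> {..min t n}" by auto
        then show False using that(1) by blast
      qed
      then have "int i < int B \<or> int L - int i - int A < 0 \<or> int M - int i < 0"
        unfolding LM by linarith
      then show ?thesis using that(2) unfolding Burge_def slope by (auto simp: gbinom_int_eq_0 of_nat_diff)
    qed
    have T: "?T (B + k) = q ^ B\<^sup>2 * ?S k" if "k \<le> min t n" for k
    proof -
      have "gbinom_int q (2 * L + M - (B + k)) (2 * L) = gbinom q (2 * A + t + (2 * B + t) + n - k) (2 * A + t + (2 * B + t))"
        unfolding gbinom_int_of_nat[symmetric] using that by (simp add: LM of_nat_diff algebra_simps)
      moreover have Lk: "int (L - (B + k)) = int L - int (B + k)"
        using that LM by (simp add: of_nat_diff)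
      moreover have "gbinom_int q (int L - int (B + k) + int (B + k) + a - b) (int L - int (B + k) + a) = gbinom q (2 * A + t) k"
        unfolding gbinom_int_of_nat[symmetric] using that LM slope by (subst gbinom_int_sym'[where k = "int k"]) (auto simp: algebra_simps)
      moreover have "gbinom_int q (int L - int (B + k) + int (B + k) - a + b) (int L - int (B + k) - a) = gbinom q (2 * B + t) (k + 2 * B)"
        unfolding gbinom_int_of_nat[symmetric] using that LM slope by (subst gbinom_int_sym'[where k = "int k + 2 * int B"]) (auto simp: algebra_simps)
      moreover have "(B + k)\<^sup>2 = B\<^sup>2 + k * (k + 2 * B)" by (simp add: power2_eq_square algebra_simps)
      ultimately show ?thesis unfolding Burge_def Lk by (simp add: power_add mult_ac)
    qed
    have "(\<Sum>i\<le>L. ?T i) = (\<Sum>i\<in>(+) B ` {..min t n}. ?T i)"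
      by (rule sum.mono_neutral_right) (use z LM in auto)
    also have "\<dots> = (\<Sum>k\<le>min t n. ?T (B + k))"
      by (subst sum.reindex) auto
    also have "\<dots> = (\<Sum>k\<le>min t n. q ^ B\<^sup>2 * ?S k)"
      by (intro sum.cong refl T) auto
    also have "\<dots> = q ^ B\<^sup>2 * (\<Sum>k\<le>n. ?S k)"
      unfolding sum_distrib_left by (rule sum.mono_neutral_left) (auto simp: gbinom_eq_0)
    also have "\<dots> = q ^ B\<^sup>2 * (gbinom q (2 * A + t + n + 2 * B) n * gbinom q (2 * B + t + n) (n + 2 * B))"
      by (subst q_Saalschuetz[OF q]) (rule refl)
    also have "gbinom q (2 * A + t + n + 2 * B) n = gbinom_int q (L + M + (a + b) - b) (L + (a + b))"
      unfolding gbinom_int_of_nat[symmetric] using LM slope by (subst gbinom_int_sym'[where k = "int L + (a + b)"]) (auto simp: algebra_simps)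
    also have "gbinom q (2 * B + t + n) (n + 2 * B) = gbinom_int q (L + M - (a + b) + b) (L - (a + b))"
      unfolding gbinom_int_of_nat[symmetric] using LM slope by (subst gbinom_int_sym'[where k = "int L - (a + b)"]) (auto simp: algebra_simps)
    finally show ?thesis unfolding Burge_def slope by simp
  qed
qed

text \<open>This is \<open>Burge_transform\<close> for M -> infinity, multiplied by (q)_(2L). A
  field has no limits, so the proof is direct: the binomial containing M is gone, and q-Vandermonde
  takes the place of the Saalschuetz sum.\<close>

lemma Burge_transform_limit:
  fixes L :: nat and a b :: int
  assumes q: "no_root_of_unity q" and "0 \<le> a" "0 \<le> b"
  shows "(\<Sum>i\<le>L. q ^ i\<^sup>2 * Burge q (L - i) i a b) = q ^ (nat b)\<^sup>2 * gbinom_int q (2 * L) (L - (a + b))"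
proof -
  obtain A B where slope: "a = int A" "b = int B" using assms by (metis nonneg_int_cases)
  show ?thesis
  proof (cases "L < A + B")
    case True
    have "q ^ i\<^sup>2 * Burge q (L - i) i a b = 0" if "i \<le> L" for i
    proof -
      have "i < int B \<or> int L - int i - int A < 0"
        using True that by auto
      then show ?thesis using that unfolding slope Burge_def by (auto simp: gbinom_int_eq_0)
    qed
    then have "(\<Sum>i\<le>L. q ^ i\<^sup>2 * Burge q (L - i) i a b) = 0"
      by (intro sum.neutral) simp
    moreover have "gbinom_int q (2 * L) (L - (a + b)) = 0"
      using True unfolding slope by (auto simp: gbinom_int_eq_0)
    ultimately show ?thesis by simp
  next
    case False
    then obtain t where L: "L = A + B + t"
      by (auto simp: not_less le_iff_add)
    let ?T = "\<lambda>i. q ^ i\<^sup>2 * Burge q (L - i) i a b"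
    let ?S = "\<lambda>k. q ^ (k * (2 * B + t + k - t)) * gbinom q (2 * A + t) k * gbinom q (2 * B + t) (t - k)"
    have z: "?T i = 0" if "i \<notin> (+) B ` {..t}" "i \<le> L" for i
    proof -
      have "i < B \<or> i > B + t"
      proof (rule ccontr)
        assume "\<not> ?thesis"
        then have "i = B + (i - B) \<and> i - B \<in> {..t}" by auto
        then show False using that(1) by blast
      qed
      then have "int i < int B \<or> int L - int i - int A < 0"
        unfolding L by linarith
      then show ?thesis using that(2) unfolding Burge_def slope by (auto simp: gbinom_int_eq_0 of_nat_diff)
    qed
    have T: "?T (B + k) = q ^ B\<^sup>2 * ?S k" if "k \<le> t" for k
    proof -
      have Lk: "int (L - (B + k)) = int L - int (B + k)"
        using that L by (simp add: of_nat_diff)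
      have "gbinom_int q (int L - int (B + k) + int (B + k) + a - b) (int L - int (B + k) + a) = gbinom q (2 * A + t) k"
        unfolding gbinom_int_of_nat[symmetric] using that L slope by (subst gbinom_int_sym'[where k = "int k"]) (auto simp: algebra_simps)
      moreover have "gbinom_int q (int L - int (B + k) + int (B + k) - a + b) (int L - int (B + k) - a) = gbinom q (2 * B + t) (t - k)"
        unfolding gbinom_int_of_nat[symmetric] using that L slope by (auto simp: algebra_simps of_nat_diff)
      moreover have "(B + k)\<^sup>2 = B\<^sup>2 + k * (2 * B + t + k - t)" by (simp add: power2_eq_square algebra_simps)
      ultimately show ?thesis unfolding Burge_def Lk by (simp add: power_add mult_ac)
    qed
    have "(\<Sum>i\<le>L. ?T i) = (\<Sum>i\<in>(+) B ` {..t}. ?T i)"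
      by (rule sum.mono_neutral_right) (use z L in auto)
    also have "\<dots> = (\<Sum>k\<le>t. ?T (B + k))"
      by (subst sum.reindex) auto
    also have "\<dots> = (\<Sum>k\<le>t. q ^ B\<^sup>2 * ?S k)"
      by (intro sum.cong refl T) auto
    also have "\<dots> = q ^ B\<^sup>2 * gbinom q (2 * A + t + (2 * B + t)) t"
      unfolding sum_distrib_left[symmetric] q_Vandermonde[OF q] ..
    also have "gbinom q (2 * A + t + (2 * B + t)) t = gbinom_int q (2 * L) (L - (a + b))"
      unfolding gbinom_int_of_nat[symmetric] using L slope by (simp add: algebra_simps)
    finally show ?thesis unfolding slope by simp
  qed
qed

section \<open>The finite Jacobi triple product\<close>

definition tri :: "int \<Rightarrow> nat" where
  "tri j = nat (j * (j - 1) div 2)"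

definition alt_sign :: "int \<Rightarrow> 'a::field" where
  "alt_sign j = (- 1) ^ nat \<bar>j\<bar>"

text \<open>For u v = p this is (-u)^j p^(j(j-1)/2); the second branch avoids negative powers, so that
  q = 0 needs no separate treatment.\<close>

definition jacobi_term :: "'a::field \<Rightarrow> 'a \<Rightarrow> 'a \<Rightarrow> int \<Rightarrow> 'a" where
  "jacobi_term u v p j = (if 0 \<le> j then (- u) ^ nat j * p ^ tri j else (- v) ^ nat (- j) * p ^ tri (- j))"

lemma tri_int_Suc: "tri (int (Suc n)) = tri (int n) + n"
proof -
  have "int (Suc n) * (int (Suc n) - 1) = int n * (int n - 1) + int n * 2"
    by (simp add: algebra_simps)
  then have "int (Suc n) * (int (Suc n) - 1) div 2 = int n * (int n - 1) div 2 + int n"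
    by simp
  moreover have "0 \<le> int n * (int n - 1) div 2"
    by (cases n) auto
  ultimately show ?thesis unfolding tri_def by (simp add: nat_add_distrib)
qed

lemma tri_uminus: "tri (- int n) = tri (int n) + n"
  using tri_int_Suc[of n] unfolding tri_def by (simp add: algebra_simps)

lemma tri_0 [simp]: "tri 0 = 0"
  by (simp add: tri_def)

text \<open>Consecutive terms have ratio -u p^j. The power p^(n-j) on the left keeps all exponents
  nonnegative, and it is the power that Pascal's rule produces in
  \<open>finite_Jacobi_triple\<close>.\<close>

lemma jacobi_term_up:
  assumes "u * v = p" "\<bar>j\<bar> \<le> int n"
  shows "jacobi_term u v p (j + 1) * p ^ nat (int n - j) = - u * p ^ n * jacobi_term u v p j"
proof (cases "0 \<le> j")
  case True
  then obtain k where k: "j = int k" by (metis nonneg_int_cases)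
  have "n = k + (n - k)" using assms k by auto
  then have "p ^ n = p ^ k * p ^ (n - k)" by (metis power_add)
  moreover have "nat (int n - int k) = n - k" "nat (int k + 1) = Suc k" by auto
  moreover have "tri (int k + 1) = tri (int k) + k" using tri_int_Suc[of k] by (simp add: add_ac)
  ultimately show ?thesis unfolding k jacobi_term_def by (simp add: power_add mult_ac)
next
  case False
  then obtain k where k: "j = - int (Suc k)" by (metis int_cases not_less of_nat_0_le_iff)
  have t: "tri (int (Suc k)) = tri (int k) + k" by (rule tri_int_Suc)
  have m: "nat (int n - j) = n + Suc k" using k by simp
  have "jacobi_term u v p (j + 1) = (- v) ^ k * p ^ tri (int k)"
  proof -
    have j1: "j + 1 = - int k" using k by simp
    show ?thesis unfolding jacobi_term_def j1 by (cases "k = 0") (simp_all del: of_nat_Suc)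
  qed
  moreover have "jacobi_term u v p j = (- v) ^ Suc k * p ^ tri (int (Suc k))"
  proof -
    have "nat (- j) = Suc k" "- j = int (Suc k)" "\<not> 0 \<le> j" using k by auto
    then show ?thesis unfolding jacobi_term_def by simp
  qed
  ultimately show ?thesis unfolding m t unfolding assms(1)[symmetric] by (simp add: power_add power_mult_distrib mult_ac)
qed

lemma jacobi_term_down:
  assumes "u * v = p" "\<bar>j\<bar> \<le> int n"
  shows "jacobi_term u v p (j - 1) * p ^ nat (int n + j) = - v * p ^ n * jacobi_term u v p j"
proof -
  have s: "jacobi_term u v p (- i) = jacobi_term v u p i" for i
    by (auto simp: jacobi_term_def)
  show ?thesis
    using jacobi_term_up[of v u p "- j" n] assms s[of "- j + 1"] s[of "- j"] by (simp add: mult.commute add.commute)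
qed

text \<open>Two Pascal steps express [2n+2; n+1+j] by [2n; n+j] and [2n; n+j-1], [2n; n+j+1]. By
  \<open>jacobi_term_up\<close> and \<open>jacobi_term_down\<close> the shifted sums are multiples
  of the unshifted one, so the sum gains the factor 1 + p^(2n+1) - u p^n - v p^n, which equals (1 -
  u p^n)(1 - v p^n) because u v = p.\<close>

lemma finite_Jacobi_triple:
  assumes q: "no_root_of_unity p" and uv: "u * v = p"
  shows "(\<Sum>j = - int n..int n. jacobi_term u v p j * gbinom_int p (2 * int n) (int n + j))
    = (\<Prod>i<n. 1 - u * p ^ i) * (\<Prod>i<n. 1 - v * p ^ i)"
proof (induction n)
  case 0
  then show ?case by (simp add: jacobi_term_def gbinom_int_def gbinom_0_right q)
next
  case (Suc n)
  let ?S = "\<Sum>j = - int n..int n. jacobi_term u v p j * gbinom_int p (2 * int n) (int n + j)"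
  let ?I = "{- int (Suc n)..int (Suc n)}"
  have P: "gbinom_int p (2 * int (Suc n)) (int (Suc n) + j) = gbinom_int p (2 * int n) (int n + j) * (1 + p ^ (2 * n + 1))
     + p ^ nat (int n + 1 - j) * gbinom_int p (2 * int n) (int n + j - 1) + p ^ nat (int n + 1 + j) * gbinom_int p (2 * int n) (int n + j + 1)" 
    if "j \<in> ?I" for j
  proof -
    define k where "k = int n + 1 + j"
    have "0 \<le> k" "k \<le> 2 * int n + 2" using that by (auto simp: k_def)
    have a: "gbinom_int p (2 * int n + 2) k = gbinom_int p (2 * int n + 1) k + p ^ nat (2 * int n + 2 - k) * gbinom_int p (2 * int n + 1) (k - 1)"
      using gbinom_int_Pascal[OF q, of "2 * int n + 1" k] by (simp add: add.commute)
    have b: "gbinom_int p (2 * int n + 1) k = p ^ nat k * gbinom_int p (2 * int n) k + gbinom_int p (2 * int n) (k - 1)"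
      "gbinom_int p (2 * int n + 1) (k - 1) = p ^ nat (k - 1) * gbinom_int p (2 * int n) (k - 1) + gbinom_int p (2 * int n) (k - 2)"
      using gbinom_int_Pascal'[OF q, of "2 * int n" k] gbinom_int_Pascal'[OF q, of "2 * int n" "k - 1"] by simp_all
    \<comment> \<open>For k = 0 the exponents do not add up, as \<open>nat (k - 1)\<close>
      truncates, but then the binomial is 0.\<close>
    have c: "p ^ nat (2 * int n + 2 - k) * (p ^ nat (k - 1) * gbinom_int p (2 * int n) (k - 1)) = p ^ (2 * n + 1) * gbinom_int p (2 * int n) (k - 1)"
    proof (cases "k = 0")
      case False
      then have "nat (2 * int n + 2 - k) + nat (k - 1) = 2 * n + 1" using \<open>0 \<le> k\<close> \<open>k \<le> 2 * int n + 2\<close> by simp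
      then show ?thesis by (metis mult.assoc power_add)
    qed (simp add: gbinom_int_eq_0)
    have e: "2 * int (Suc n) = 2 * int n + 2" "int (Suc n) + j = k" "int n + j = k - 1" "int n + 1 - j = 2 * int n + 2 - k"
      "int n + 1 + j = k" "int n + j - 1 = k - 2" "k - 1 - 1 = k - 2" "k - 1 + 1 = k" by (simp_all add: k_def)
    show ?thesis unfolding e a b distrib_left c by (simp add: algebra_simps)
  qed
  have 1: "(\<Sum>j\<in>?I. jacobi_term u v p j * (gbinom_int p (2 * int n) (int n + j) * (1 + p ^ (2 * n + 1)))) = (1 + p ^ (2 * n + 1)) * ?S"
    unfolding sum_distrib_left by (rule sum.mono_neutral_cong_right) (auto simp: gbinom_int_eq_0)
  have 2: "(\<Sum>j\<in>?I. jacobi_term u v p j * (p ^ nat (int n + 1 - j) * gbinom_int p (2 * int n) (int n + j - 1))) = - u * p ^ n * ?S"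
  proof -
    have "(\<Sum>j\<in>?I. jacobi_term u v p j * (p ^ nat (int n + 1 - j) * gbinom_int p (2 * int n) (int n + j - 1)))
      = (\<Sum>j\<in>{- int n + 1..int n + 1}. jacobi_term u v p j * (p ^ nat (int n + 1 - j) * gbinom_int p (2 * int n) (int n + j - 1)))"
      by (rule sum.mono_neutral_right) (auto simp: gbinom_int_eq_0)
    also have "\<dots> = (\<Sum>j = - int n..int n. jacobi_term u v p (j + 1) * p ^ nat (int n - j) * gbinom_int p (2 * int n) (int n + j))"
      by (rule sum.reindex_bij_witness[of _ "\<lambda>j. j + 1" "\<lambda>j. j - 1"]) (auto simp: algebra_simps)
    also have "\<dots> = (\<Sum>j = - int n..int n. - u * p ^ n * (jacobi_term u v p j * gbinom_int p (2 * int n) (int n + j)))"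
      by (intro sum.cong refl, subst jacobi_term_up[OF uv]) auto
    finally show ?thesis by (simp add: sum_distrib_left)
  qed
  have 3: "(\<Sum>j\<in>?I. jacobi_term u v p j * (p ^ nat (int n + 1 + j) * gbinom_int p (2 * int n) (int n + j + 1))) = - v * p ^ n * ?S"
  proof -
    have "(\<Sum>j\<in>?I. jacobi_term u v p j * (p ^ nat (int n + 1 + j) * gbinom_int p (2 * int n) (int n + j + 1)))
      = (\<Sum>j\<in>{- int n - 1..int n - 1}. jacobi_term u v p j * (p ^ nat (int n + 1 + j) * gbinom_int p (2 * int n) (int n + j + 1)))"
      by (rule sum.mono_neutral_right) (auto simp: gbinom_int_eq_0)
    also have "\<dots> = (\<Sum>j = - int n..int n. jacobi_term u v p (j - 1) * p ^ nat (int n + j) * gbinom_int p (2 * int n) (int n + j))"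
      by (rule sum.reindex_bij_witness[of _ "\<lambda>j. j - 1" "\<lambda>j. j + 1"]) (auto simp: algebra_simps)
    also have "\<dots> = (\<Sum>j = - int n..int n. - v * p ^ n * (jacobi_term u v p j * gbinom_int p (2 * int n) (int n + j)))"
      by (intro sum.cong refl, subst jacobi_term_down[OF uv]) auto
    finally show ?thesis by (simp add: sum_distrib_left)
  qed
  have "(\<Sum>j\<in>?I. jacobi_term u v p j * gbinom_int p (2 * int (Suc n)) (int (Suc n) + j))
     = (\<Sum>j\<in>?I. jacobi_term u v p j * (gbinom_int p (2 * int n) (int n + j) * (1 + p ^ (2 * n + 1))) 
        + jacobi_term u v p j * (p ^ nat (int n + 1 - j) * gbinom_int p (2 * int n) (int n + j - 1))
        + jacobi_term u v p j * (p ^ nat (int n + 1 + j) * gbinom_int p (2 * int n) (int n + j + 1)))"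
    by (intro sum.cong refl, subst P) (simp_all add: distrib_left)
  also have "\<dots> = (1 + p ^ (2 * n + 1)) * ?S - u * p ^ n * ?S - v * p ^ n * ?S"
    unfolding sum.distrib 1 2 3 by simp
  also have "\<dots> = ?S * ((1 - u * p ^ n) * (1 - v * p ^ n))"
  proof -
    have "(u * p ^ n) * (v * p ^ n) = (u * v) * (p ^ n * p ^ n)"
      by (simp only: mult_ac)
    also have "\<dots> = p ^ (2 * n + 1)"
      unfolding uv by (simp add: mult_2 power_add)
    finally have "p ^ (2 * n + 1) = (u * p ^ n) * (v * p ^ n)" ..
    then show ?thesis by (simp only: algebra_simps mult_1_left mult_1_right)
  qed
  finally show ?case unfolding Suc.IH by (simp add: mult_ac)
qed

section \<open>Theta exponents and the identity that starts the iteration\<close>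

definition inv_qfac :: "'a::field \<Rightarrow> int \<Rightarrow> 'a" where
  "inv_qfac q k = (if k < 0 then 0 else 1 / qfac q (nat k))"

definition theta_exp :: "nat \<Rightarrow> int \<Rightarrow> nat" where
  "theta_exp k j = tri j + k * (nat \<bar>j\<bar>)\<^sup>2"

text \<open>One specialization of the triple product serves twice: m = 1 gives u = 1, v = q for
  \<open>Burge_seed\<close>, and m = a*b gives the product side of the theorem.\<close>

lemma jacobi_term_power:
  assumes "m > 0"
  shows "q ^ (m - 1) * q ^ m = q ^ (2 * m - 1)" "jacobi_term (q ^ (m - 1)) (q ^ m) (q ^ (2 * m - 1)) j = alt_sign j * q ^ theta_exp (m - 1) j"
proof -
  obtain k where m: "m = Suc k" using assms by (cases m) auto
  show "q ^ (m - 1) * q ^ m = q ^ (2 * m - 1)"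
    unfolding power_add[symmetric] m by (rule arg_cong[where f = "(^) q"]) simp
  have mm: "m - 1 = k" "2 * m - 1 = 2 * k + 1" "m = Suc k" using m by auto
  have t: "2 * tri (int i) + i = i * i" for i
    by (induction i) (use tri_int_Suc in auto)
  have t1: "k * i + (2 * k + 1) * tri (int i) = tri (int i) + k * i\<^sup>2" for i
  proof -
    have "k * i\<^sup>2 = k * (2 * tri (int i) + i)" unfolding t power2_eq_square ..
    then show ?thesis by (simp add: algebra_simps)
  qed
  show "jacobi_term (q ^ (m - 1)) (q ^ m) (q ^ (2 * m - 1)) j = alt_sign j * q ^ theta_exp (m - 1) j"
  proof (cases "0 \<le> j")
    case True
    then obtain i where j: "j = int i" by (metis nonneg_int_cases)
    have "jacobi_term (q ^ (m - 1)) (q ^ m) (q ^ (2 * m - 1)) j = (- 1) ^ i * ((q ^ k) ^ i * (q ^ (2 * k + 1)) ^ tri (int i))"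
      unfolding jacobi_term_def j mm(1,2) power_minus[of "q ^ k"] by (simp del: power_Suc)
    also have "\<dots> = (- 1) ^ i * q ^ (k * i + (2 * k + 1) * tri (int i))"
      by (simp only: power_mult[symmetric] power_add[symmetric])
    finally have "jacobi_term (q ^ (m - 1)) (q ^ m) (q ^ (2 * m - 1)) j = (- 1) ^ i * q ^ (k * i + (2 * k + 1) * tri (int i))" .
    then show ?thesis unfolding t1 by (simp add: theta_exp_def alt_sign_def j m)
  next
    case False
    then obtain i where j: "j = - int i" by (metis int_cases not_less of_nat_0_le_iff)
    have "jacobi_term (q ^ (m - 1)) (q ^ m) (q ^ (2 * m - 1)) j = (- 1) ^ i * ((q ^ Suc k) ^ i * (q ^ (2 * k + 1)) ^ tri (int i))"
      using False unfolding jacobi_term_def j mm(1,2) unfolding mm(3) power_minus[of "q ^ Suc k"] by (simp del: power_Suc)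
    also have "\<dots> = (- 1) ^ i * q ^ (Suc k * i + (2 * k + 1) * tri (int i))"
      by (simp only: power_mult[symmetric] power_add[symmetric])
    also have "Suc k * i + (2 * k + 1) * tri (int i) = theta_exp (m - 1) j"
      using t1[of i] by (simp add: theta_exp_def j m tri_uminus)
    finally show ?thesis by (simp add: alt_sign_def j)
  qed
qed

text \<open>In this expansion only the last factor depends on j, so the sum over j can be carried
  out first. For j = J >= 0 put r = J + k: the factor [L+M; L-J] comes out, and
  \<open>q_Vandermonde'\<close> sums the rest. Negative j follows by
  \<open>Burge_uminus\<close>.\<close>

lemma Burge_diag:
  fixes L M :: nat
  assumes q: "no_root_of_unity q"
  shows "Burge q L M j j = (\<Sum>r\<le>L. q ^ ((L - r) * (M - r)) * gbinom q (L + M) (L - r) * gbinom q (M + r) (2 * r)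
     * gbinom_int q (2 * int r) (int r + j))"
proof -
  have pos: "Burge q L M (int J) (int J) = (\<Sum>r\<le>L. q ^ ((L - r) * (M - r)) * gbinom q (L + M) (L - r) * gbinom q (M + r) (2 * r)
     * gbinom_int q (2 * int r) (int r + int J))" for J
  proof (cases "L < J \<or> M < J")
    case True
    have "Burge q L M (int J) (int J) = 0"
      using True by (auto simp: Burge_def gbinom_int_eq_0)
    moreover have "gbinom q (M + r) (2 * r) = 0 \<or> gbinom_int q (2 * int r) (int r + int J) = 0" if "r \<le> L" for r
      using True that by (cases "r < J") (auto simp: gbinom_int_eq_0 gbinom_eq_0)
    then have "(\<Sum>r\<le>L. q ^ ((L - r) * (M - r)) * gbinom q (L + M) (L - r) * gbinom q (M + r) (2 * r)
      * gbinom_int q (2 * int r) (int r + int J)) = 0"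
      by (intro sum.neutral ballI) auto
    ultimately show ?thesis by simp
  next
    case False
    then obtain u v where LM: "L = J + u" "M = J + v"
      by (auto simp: not_less le_iff_add)
    let ?T = "\<lambda>r. q ^ ((L - r) * (M - r)) * gbinom q (L + M) (L - r) * gbinom q (M + r) (2 * r) * gbinom_int q (2 * int r) (int r + int J)"
    let ?S = "\<lambda>k. q ^ ((u - k) * (v - k)) * gbinom q u k * gbinom q (2 * J + v) (v - k)"
    have nz: "qfac q n \<noteq> 0" for n using qfac_nonzero[OF q] .
    have z: "?T i = 0" if "i \<notin> (+) J ` {..min u v}" "i \<le> L" for i
    proof -
      have "i < J \<or> i > J + u \<or> i > J + v"
      proof (rule ccontr)
        assume "\<not> ?thesis"
        then have "i = J + (i - J) \<and> i - J \<in> {..min u v}" by auto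
        then show False using that(1) by blast
      qed
      then have "i < J \<or> M < i" using that(2) LM by auto
      then show ?thesis by (auto simp: gbinom_int_eq_0 gbinom_eq_0)
    qed
    have T: "?T (J + k) = gbinom q (L + M) u * ?S k" if "k \<le> min u v" for k
    proof -
      have e: "L - (J + k) = u - k" "M - (J + k) = v - k" using LM by auto
      have "gbinom_int q (2 * int (J + k)) (int (J + k) + int J) = gbinom_int q (2 * int (J + k)) (int k)"
        by (rule gbinom_int_sym') simp
      then have 1: "gbinom_int q (2 * int (J + k)) (int (J + k) + int J) = gbinom q (2 * (J + k)) k"
        unfolding gbinom_int_of_nat[symmetric] by simp
      have "u - k \<le> L + M" "2 * (J + k) \<le> M + (J + k)" "k \<le> 2 * (J + k)" "u \<le> L + M" "k \<le> u" "v - k \<le> 2 * J + v"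
        "L + M - (u - k) = M + (J + k)" "M + (J + k) - 2 * (J + k) = v - k" "2 * (J + k) - k = 2 * J + k" 
        "L + M - u = 2 * J + v" "2 * J + v - (v - k) = 2 * J + k"
        using that LM by auto
      then have "gbinom q (L + M) (u - k) * gbinom q (M + (J + k)) (2 * (J + k)) * gbinom q (2 * (J + k)) k
        = gbinom q (L + M) u * gbinom q u k * gbinom q (2 * J + v) (v - k)"
        unfolding gbinom_def using nz by (simp add: divide_simps add.commute[of k "2 * J"])
      then have G: "gbinom q (L + M) (u - k) * (gbinom q (M + (J + k)) (2 * (J + k)) * gbinom q (2 * (J + k)) k)
        = gbinom q (L + M) u * (gbinom q u k * gbinom q (2 * J + v) (v - k))"
        by (simp only: mult.assoc)
      show ?thesis unfolding e 1 unfolding mult.assoc G by (simp only: mult.left_commute)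
    qed
    have "(\<Sum>i\<le>L. ?T i) = (\<Sum>i\<in>(+) J ` {..min u v}. ?T i)"
      by (rule sum.mono_neutral_right) (use z LM in auto)
    also have "\<dots> = (\<Sum>k\<le>min u v. ?T (J + k))"
      by (subst sum.reindex) auto
    also have "\<dots> = (\<Sum>k\<le>min u v. gbinom q (L + M) u * ?S k)"
      by (intro sum.cong refl T) auto
    also have "\<dots> = gbinom q (L + M) u * (\<Sum>k\<le>v. ?S k)"
      unfolding sum_distrib_left by (rule sum.mono_neutral_left) (auto simp: gbinom_eq_0)
    also have "\<dots> = gbinom q (L + M) u * gbinom q (u + (2 * J + v)) v"
      unfolding q_Vandermonde'[OF q] ..
    also have "gbinom q (L + M) u = gbinom_int q (L + M + int J - int J) (L - int J)"
      unfolding gbinom_int_of_nat[symmetric] using LM by simp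
    also have "gbinom q (u + (2 * J + v)) v = gbinom_int q (L + M + int J - int J) (L + int J)"
      unfolding gbinom_int_of_nat[symmetric] using LM by (subst gbinom_int_sym'[where k = "int L + int J"]) (auto simp: algebra_simps)
    finally show ?thesis unfolding Burge_def by (simp add: mult.commute)
  qed
  have neg: "Burge q L M (- j) (- j) = Burge q L M j j" by (rule Burge_uminus)
  have qn: "gbinom_int q (2 * int r) (int r + - j) = gbinom_int q (2 * int r) (int r + j)" for r j
    by (rule gbinom_int_sym') simp
  show ?thesis
  proof (cases "0 \<le> j")
    case True
    then show ?thesis using pos[of "nat j"] by simp
  next
    case False
    then show ?thesis using pos[of "nat (- j)"] by (simp add: neg qn[of _ j, simplified])
  qed
qed

text \<open>By the preceding expansion only r = 0 survives: the sum over j is the finite triple product at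
  u = 1, v = q, which vanishes for r > 0.\<close>

lemma Burge_seed:
  fixes L M :: nat
  assumes q: "no_root_of_unity q" and "L \<le> N"
  shows "(\<Sum>j = - int N..int N. alt_sign j * q ^ tri j * Burge q L M j j) = q ^ (L * M) * gbinom q (L + M) L"
proof -
  have D: "(\<Sum>j = - int N..int N. alt_sign j * q ^ tri j * gbinom_int q (2 * int r) (int r + j)) = (if r = 0 then 1 else 0)" if "r \<le> L" for r
  proof -
    have "(\<Sum>j = - int N..int N. alt_sign j * q ^ tri j * gbinom_int q (2 * int r) (int r + j))
      = (\<Sum>j = - int r..int r. jacobi_term 1 q q j * gbinom_int q (2 * int r) (int r + j))"
      using that assms jacobi_term_power(2)[of 1 q] by (intro sum.mono_neutral_cong_right) (auto simp: gbinom_int_eq_0 theta_exp_def)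
    also have "\<dots> = (if r = 0 then 1 else 0)"
      unfolding finite_Jacobi_triple[OF q mult_1_left] by (cases r) (auto simp: lessThan_Suc_eq_insert_0)
    finally show ?thesis .
  qed
  have "(\<Sum>j = - int N..int N. alt_sign j * q ^ tri j * Burge q L M j j)
    = (\<Sum>j = - int N..int N. \<Sum>r\<le>L. q ^ ((L - r) * (M - r)) * gbinom q (L + M) (L - r) * gbinom q (M + r) (2 * r)
       * (alt_sign j * q ^ tri j * gbinom_int q (2 * int r) (int r + j)))"
    unfolding Burge_diag[OF q] sum_distrib_left by (simp add: mult_ac)
  also have "\<dots> = (\<Sum>r\<le>L. q ^ ((L - r) * (M - r)) * gbinom q (L + M) (L - r) * gbinom q (M + r) (2 * r)
       * (\<Sum>j = - int N..int N. alt_sign j * q ^ tri j * gbinom_int q (2 * int r) (int r + j)))"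
    unfolding sum_distrib_left by (rule sum.swap)
  also have "\<dots> = (\<Sum>r\<le>L. if r = 0 then q ^ ((L - r) * (M - r)) * gbinom q (L + M) (L - r) * gbinom q (M + r) (2 * r) else 0)"
    by (intro sum.cong refl, subst D) auto
  also have "\<dots> = q ^ (L * M) * gbinom q (L + M) L"
    using q by (simp add: gbinom_0_right)
  finally show ?thesis .
qed

text \<open>The Boolean list describes consecutive rows of C, with True marking the rows in Tset. The pair
  (x, y) stands for (m (j-1), m j), so that Burge's parameters are L = y and M = x - y.\<close>

fun Wsum :: "'a::field \<Rightarrow> bool list \<Rightarrow> nat \<Rightarrow> nat \<Rightarrow> 'a" where
  "Wsum q [] x y = q ^ (y * (x - y)) * gbinom q x y"
| "Wsum q (t # ts) x y = (\<Sum>z\<le>y. q ^ (if t then z else y - z)\<^sup>2 * gbinom q (x + (if t then y - z else z)) (2 * y) * Wsum q ts y z)"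

text \<open>The pair whose ratio is the continued fraction encoded by the list.\<close>

fun slope :: "bool list \<Rightarrow> nat \<times> nat" where
  "slope [] = (1, 1)"
| "slope (t # ts) = (fst (slope ts) + snd (slope ts), if t then fst (slope ts) else snd (slope ts))"

lemma slope_pos: "fst (slope ts) > 0" "snd (slope ts) > 0"
  by (induction ts) auto

section \<open>Iterating Burge's transformation\<close>

lemma theta_exp_add: "theta_exp k j + (b * nat \<bar>j\<bar>)\<^sup>2 = theta_exp (k + b\<^sup>2) j"
  by (simp add: theta_exp_def power_mult_distrib algebra_simps)

text \<open>Parameters proportional to j have the sign of j; changing both signs leaves Burge's
  product alone, so |j| may replace j.\<close>

lemma Burge_transform_int:
  fixes L M \<alpha> \<beta> :: nat and j :: int
  assumes q: "no_root_of_unity q"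
  shows "(\<Sum>i\<le>L. q ^ i\<^sup>2 * gbinom_int q (2 * L + M - i) (2 * L) * Burge q (L - i) i (\<alpha> * j) (\<beta> * j))
    = q ^ (\<beta> * nat \<bar>j\<bar>)\<^sup>2 * Burge q L M ((\<alpha> + \<beta>) * j) (\<beta> * j)"
    "(\<Sum>i\<le>L. q ^ i\<^sup>2 * Burge q (L - i) i (\<alpha> * j) (\<beta> * j))
    = q ^ (\<beta> * nat \<bar>j\<bar>)\<^sup>2 * gbinom_int q (2 * L) (L - (\<alpha> + \<beta>) * j)"
proof -
  define s where "s = (if 0 \<le> j then (1::int) else -1)"
  have j: "\<bar>j\<bar> = s * j" by (simp add: s_def)
  have B: "Burge q x y (\<alpha> * j) (\<beta> * j) = Burge q x y (\<alpha> * \<bar>j\<bar>) (\<beta> * \<bar>j\<bar>)" for x y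
    using Burge_uminus[of q x y "\<alpha> * j" "\<beta> * j"] by (cases "0 \<le> j") auto
  have B': "Burge q x y ((\<alpha> + \<beta>) * j) (\<beta> * j) = Burge q x y (\<alpha> * \<bar>j\<bar> + \<beta> * \<bar>j\<bar>) (\<beta> * \<bar>j\<bar>)" for x y
    using Burge_uminus[of q x y "(\<alpha> + \<beta>) * j" "\<beta> * j"] by (cases "0 \<le> j") (auto simp: algebra_simps)
  have Q: "gbinom_int q (2 * L) (L - (\<alpha> + \<beta>) * j) = gbinom_int q (2 * L) (L - (\<alpha> * \<bar>j\<bar> + \<beta> * \<bar>j\<bar>))"
    by (cases "0 \<le> j") (auto simp: algebra_simps intro: gbinom_int_sym')
  have n: "nat (\<beta> * \<bar>j\<bar>) = \<beta> * nat \<bar>j\<bar>" by (simp add: nat_mult_distrib)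
  show "(\<Sum>i\<le>L. q ^ i\<^sup>2 * gbinom_int q (2 * L + M - i) (2 * L) * Burge q (L - i) i (\<alpha> * j) (\<beta> * j))
    = q ^ (\<beta> * nat \<bar>j\<bar>)\<^sup>2 * Burge q L M ((\<alpha> + \<beta>) * j) (\<beta> * j)"
    unfolding B B' using Burge_transform[OF q, of "\<alpha> * \<bar>j\<bar>" "\<beta> * \<bar>j\<bar>" L M] n by simp
  show "(\<Sum>i\<le>L. q ^ i\<^sup>2 * Burge q (L - i) i (\<alpha> * j) (\<beta> * j))
    = q ^ (\<beta> * nat \<bar>j\<bar>)\<^sup>2 * gbinom_int q (2 * L) (L - (\<alpha> + \<beta>) * j)"
    unfolding B Q using Burge_transform_limit[OF q, of "\<alpha> * \<bar>j\<bar>" "\<beta> * \<bar>j\<bar>" L] n by simp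
qed

lemma sum_flip:
  fixes f :: "nat \<Rightarrow> 'b::comm_monoid_add"
  shows "(\<Sum>z\<le>y. f (y - z)) = (\<Sum>i\<le>y. f i)"
  by (rule sum.reindex_bij_witness[of _ "\<lambda>i. y - i" "\<lambda>i. y - i"]) auto

text \<open>Induction on the list: for each fixed j, one entry is one application of
  \<open>Burge_transform_int\<close>, preceded by \<open>Burge_swap\<close> if the entry is True.
  Nonzero terms have |j| at most y, so one interval -N..N can be kept through all levels, and the
  sums over j and over the index i can be exchanged.\<close>

lemma Wsum_eq:
  assumes q: "no_root_of_unity q" and "y \<le> x" "y \<le> N"
  shows "Wsum q ts x y = (\<Sum>j = - int N..int N. alt_sign j * q ^ theta_exp (fst (slope ts) * snd (slope ts) - 1) j
     * Burge q y (x - y) (fst (slope ts) * j) (snd (slope ts) * j))"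
  using assms(2,3)
proof (induction ts arbitrary: x y)
  case Nil
  then show ?case using Burge_seed[OF q, of y N "x - y"] by (simp add: theta_exp_def)
next
  case (Cons t ts)
  define \<alpha> \<beta> where slope: "\<alpha> = fst (slope ts)" "\<beta> = snd (slope ts)"
  define \<gamma> where "\<gamma> = (if t then \<alpha> else \<beta>)"
  define \<delta> where "\<delta> = (if t then \<beta> else \<alpha>)"
  have pos: "\<alpha> > 0" "\<beta> > 0" unfolding slope by (rule slope_pos)+
  \<comment> \<open>The step contributes q^((\<gamma> j)^2), and the exponent remains the product of
    the current slope pair minus 1.\<close>
  have k: "\<alpha> * \<beta> - 1 + \<gamma>\<^sup>2 = (\<alpha> + \<beta>) * \<gamma> - 1"
    using pos by (auto simp: \<gamma>_def power2_eq_square algebra_simps)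
  have IH: "Wsum q ts y (if t then i else y - i) = (\<Sum>j = - int N..int N. alt_sign j * q ^ theta_exp (\<alpha> * \<beta> - 1) j * Burge q (y - i) i (\<delta> * j) (\<gamma> * j))"
    if "i \<le> y" for i
    using Cons.IH[of i y] Cons.IH[of "y - i" y] Cons.prems that 
    by (auto simp: slope \<gamma>_def \<delta>_def Burge_swap[of q "int i" "int y - int i"])
  \<comment> \<open>The index i of Burge's sum is z when the entry is True and y - z when it is
    False; in the latter case the sum is reversed.\<close>
  have "Wsum q (t # ts) x y = (\<Sum>i\<le>y. q ^ i\<^sup>2 * gbinom_int q (2 * y + (x - y) - i) (2 * y) * Wsum q ts y (if t then i else y - i))"
  proof (cases t)
    case True
    then show ?thesis using Cons.prems 
      by (auto intro!: sum.cong simp: gbinom_int_of_nat[symmetric] of_nat_diff algebra_simps)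
  next
    case False
    define F where "F = (\<lambda>i. q ^ i\<^sup>2 * gbinom_int q (2 * y + (x - y) - i) (2 * y) * Wsum q ts y (y - i))"
    have "Wsum q (t # ts) x y = (\<Sum>z\<le>y. F (y - z))"
      using Cons.prems False by (auto intro!: sum.cong simp: F_def gbinom_int_of_nat[symmetric] of_nat_diff algebra_simps)
    also have "\<dots> = (\<Sum>i\<le>y. F i)" by (rule sum_flip)
    finally show ?thesis using False by (simp add: F_def)
  qed
  also have "\<dots> = (\<Sum>i\<le>y. \<Sum>j = - int N..int N. alt_sign j * q ^ theta_exp (\<alpha> * \<beta> - 1) j *
      (q ^ i\<^sup>2 * gbinom_int q (2 * y + (x - y) - i) (2 * y) * Burge q (y - i) i (\<delta> * j) (\<gamma> * j)))"
    by (intro sum.cong refl, subst IH) (simp_all add: sum_distrib_left mult_ac)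
  also have "\<dots> = (\<Sum>j = - int N..int N. alt_sign j * q ^ theta_exp (\<alpha> * \<beta> - 1) j *
      (\<Sum>i\<le>y. q ^ i\<^sup>2 * gbinom_int q (2 * y + (x - y) - i) (2 * y) * Burge q (y - i) i (\<delta> * j) (\<gamma> * j)))"
    unfolding sum_distrib_left by (rule sum.swap)
  also have "\<dots> = (\<Sum>j = - int N..int N. alt_sign j * q ^ theta_exp ((\<alpha> + \<beta>) * \<gamma> - 1) j * Burge q y (x - y) ((\<delta> + \<gamma>) * j) (\<gamma> * j))"
    unfolding k[symmetric] theta_exp_add[symmetric] power_add 
    using Burge_transform_int(1)[OF q, of y "x - y" \<delta> _ \<gamma>] Cons.prems
    by (intro sum.cong refl) (simp add: of_nat_diff mult_ac)
  also have "\<delta> + \<gamma> = \<alpha> + \<beta>" by (simp add: \<gamma>_def \<delta>_def)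
  finally show ?case using Cons.prems by (simp add: slope \<gamma>_def of_nat_diff)
qed

text \<open>This is \<open>q_Vandermonde\<close> with A = t and B = N + c in the limit N ->
  infinity. The direct induction on t leaves c arbitrary, because Pascal's rule joins the two parts
  into the sum for c + 1.\<close>

lemma Bailey_step_aux:
  assumes q: "no_root_of_unity q"
  shows "(\<Sum>k\<le>t. q ^ (k * (k + c)) * gbinom q t k / qfac q (k + c)) = 1 / qfac q (t + c)"
proof (induction t arbitrary: c)
  case 0
  then show ?case by (simp add: gbinom_0_right q)
next
  case (Suc t)
  have nz: "qfac q n \<noteq> 0" for n using qfac_nonzero[OF q] .
  have nz1: "1 - q ^ Suc n \<noteq> 0" for n using q unfolding no_root_of_unity_def by (metis eq_iff_diff_eq_0 zero_less_Suc)
  let ?f = "\<lambda>k. q ^ (k * (k + c)) * q ^ k * gbinom q t k / qfac q (k + c)"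
  let ?g = "\<lambda>k. q ^ (Suc k * (Suc k + c)) * gbinom q t k / qfac q (Suc k + c)"
  have "(\<Sum>k\<le>Suc t. q ^ (k * (k + c)) * gbinom q (Suc t) k / qfac q (k + c))
    = 1 / qfac q c + (\<Sum>k\<le>t. q ^ (Suc k * (Suc k + c)) * gbinom q (Suc t) (Suc k) / qfac q (Suc k + c))"
    by (subst sum.atMost_Suc_shift) (simp add: gbinom_0_right q)
  also have "\<dots> = 1 / qfac q c + (\<Sum>k\<le>t. ?f (Suc k) + ?g k)"
    unfolding gbinom_Suc_Suc'[OF q] by (simp add: algebra_simps add_divide_distrib)
  also have "\<dots> = (1 / qfac q c + (\<Sum>k\<le>t. ?f (Suc k))) + (\<Sum>k\<le>t. ?g k)"
    by (simp add: sum.distrib)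
  also have "1 / qfac q c + (\<Sum>k\<le>t. ?f (Suc k)) = (\<Sum>k\<le>Suc t. ?f k)"
    by (subst sum.atMost_Suc_shift) (simp add: gbinom_0_right q)
  also have "\<dots> = (\<Sum>k\<le>t. ?f k)" by (simp add: gbinom_eq_0)
  also have "(\<Sum>k\<le>t. ?f k) + (\<Sum>k\<le>t. ?g k) = (\<Sum>k\<le>t. ?f k + ?g k)" by (simp add: sum.distrib)
  also have "\<dots> = (\<Sum>k\<le>t. q ^ (k * (k + Suc c)) * gbinom q t k / qfac q (k + Suc c))"
  proof (intro sum.cong refl)
    fix k
    have 1: "qfac q (k + Suc c) = qfac q (k + c) * (1 - q ^ Suc (k + c))" "qfac q (Suc k + c) = qfac q (k + c) * (1 - q ^ Suc (k + c))"
      by (simp_all only: qfac_Suc add_Suc_right add_Suc)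
    have 2: "q ^ (k * (k + c)) * q ^ k = q ^ (k * (k + Suc c))" "q ^ (Suc k * (Suc k + c)) = q ^ (k * (k + Suc c)) * q ^ Suc (k + c)"
      unfolding power_add[symmetric] by (simp_all add: algebra_simps)
    have "x / d + x * s / (d * (1 - s)) = x / (d * (1 - s))" if "d \<noteq> 0" "1 - s \<noteq> 0" for x d s :: 'a
      using that by (simp add: divide_simps) (simp add: algebra_simps)
    from this[OF nz nz1, of "q ^ (k * (k + Suc c)) * gbinom q t k" "k + c" "k + c"]
    show "?f k + ?g k = q ^ (k * (k + Suc c)) * gbinom q t k / qfac q (k + Suc c)"
      unfolding 1 2 by (simp only: mult_ac)
  qed
  finally show ?case unfolding Suc.IH by (simp only: add_Suc add_Suc_right)
qed

text \<open>Bailey's lemma relative to 1 with both free parameters sent to infinity: the kernel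
  1/((q)_(r-a) (q)_(r+a)) reproduces itself up to q^(a^2). After r = |a| + k it is
  \<open>Bailey_step_aux\<close> with c = 2|a|.\<close>

lemma Bailey_step:
  assumes q: "no_root_of_unity q"
  shows "(\<Sum>r\<le>L. q ^ r\<^sup>2 / qfac q (L - r) * (inv_qfac q (int r - a) * inv_qfac q (int r + a)))
    = q ^ (nat \<bar>a\<bar>)\<^sup>2 * (inv_qfac q (int L - a) * inv_qfac q (int L + a))"
proof -
  have pos: "(\<Sum>r\<le>L. q ^ r\<^sup>2 / qfac q (L - r) * (inv_qfac q (int r - int A) * inv_qfac q (int r + int A)))
    = q ^ A\<^sup>2 * (inv_qfac q (int L - int A) * inv_qfac q (int L + int A))" for A
  proof (cases "L < A")
    case True
    then show ?thesis by (auto simp: inv_qfac_def)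
  next
    case False
    then obtain t where L: "L = A + t" by (auto simp: not_less le_iff_add)
    have nz: "qfac q n \<noteq> 0" for n using qfac_nonzero[OF q] .
    let ?T = "\<lambda>r. q ^ r\<^sup>2 / qfac q (L - r) * (inv_qfac q (int r - int A) * inv_qfac q (int r + int A))"
    have "(\<Sum>r\<le>L. ?T r) = (\<Sum>r\<in>{A..A + t}. ?T r)"
      by (rule sum.mono_neutral_right) (auto simp: inv_qfac_def L)
    also have "\<dots> = (\<Sum>k\<le>t. ?T (A + k))"
      by (rule sum.reindex_bij_witness[of _ "\<lambda>k. A + k" "\<lambda>r. r - A"]) auto
    also have "\<dots> = (\<Sum>k\<le>t. q ^ A\<^sup>2 / qfac q t * (q ^ (k * (k + 2 * A)) * gbinom q t k / qfac q (k + 2 * A)))"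
    proof (intro sum.cong refl)
      fix k assume "k \<in> {..t}"
      moreover have "(A + k)\<^sup>2 = A\<^sup>2 + k * (k + 2 * A)"
        by (simp add: power2_eq_square algebra_simps)
      then have "q ^ (A + k)\<^sup>2 = q ^ A\<^sup>2 * q ^ (k * (k + 2 * A))"
        by (simp only: power_add)
      moreover have "nat (int (A + k) + int A) = k + 2 * A" "nat (int (A + k) - int A) = k" "L - (A + k) = t - k"
        using L by auto
      ultimately show "?T (A + k) = q ^ A\<^sup>2 / qfac q t * (q ^ (k * (k + 2 * A)) * gbinom q t k / qfac q (k + 2 * A))"
        by (simp add: inv_qfac_def gbinom_def nz)
    qed
    also have "\<dots> = q ^ A\<^sup>2 / qfac q t * (1 / qfac q (t + 2 * A))"
      unfolding sum_distrib_left[symmetric] Bailey_step_aux[OF q] ..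
    also have "\<dots> = q ^ A\<^sup>2 * (inv_qfac q (int L - int A) * inv_qfac q (int L + int A))"
    proof -
      have "nat (int L + int A) = t + 2 * A" "nat (int L - int A) = t" using L by auto
      then show ?thesis using L by (simp add: inv_qfac_def)
    qed
    finally show ?thesis .
  qed
  show ?thesis
  proof (cases "0 \<le> a")
    case True
    then show ?thesis using pos[of "nat a"] by simp
  next
    case False
    then show ?thesis using pos[of "nat (- a)"] by (simp add: mult.commute[of "inv_qfac q (_ + a)"])
  qed
qed

text \<open>The case 0 is a Burge step with M replaced by infinity, the successor case a step of Bailey's lemma.\<close>

fun Vsum :: "'a::field \<Rightarrow> nat \<Rightarrow> bool \<Rightarrow> bool list \<Rightarrow> nat \<Rightarrow> 'a" where
  "Vsum q 0 t ts y = (\<Sum>z\<le>y. 1 / qfac q (2 * y) * q ^ (if t then z else y - z)\<^sup>2 * Wsum q ts y z)"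
| "Vsum q (Suc s) t ts y = (\<Sum>r\<le>y. q ^ r\<^sup>2 / qfac q (y - r) * Vsum q s t ts r)"

text \<open>The equation of a Bailey pair relative to 1. Each of the s Bailey steps acts on the
  kernel at \<alpha> j, where \<alpha> is the first entry of the slope pair, and so adds \<alpha>^2
  to the parameter of \<open>theta_exp\<close>.\<close>

lemma Vsum_eq:
  assumes q: "no_root_of_unity q" and "y \<le> N"
  shows "Vsum q s t ts y = (\<Sum>j = - int N..int N. alt_sign j * 
      q ^ theta_exp (fst (slope (t # ts)) * snd (slope (t # ts)) - 1 + s * (fst (slope (t # ts)))\<^sup>2) j
     * (inv_qfac q (int y - fst (slope (t # ts)) * j) * inv_qfac q (int y + fst (slope (t # ts)) * j)))"
  using assms(2)
proof (induction s arbitrary: y)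
  case 0
  define \<alpha> \<beta> where slope: "\<alpha> = fst (slope ts)" "\<beta> = snd (slope ts)"
  define \<gamma> where "\<gamma> = (if t then \<alpha> else \<beta>)"
  define \<delta> where "\<delta> = (if t then \<beta> else \<alpha>)"
  have nz: "qfac q n \<noteq> 0" for n using qfac_nonzero[OF q] .
  have pos: "\<alpha> > 0" "\<beta> > 0" unfolding slope by (rule slope_pos)+
  have k: "\<alpha> * \<beta> - 1 + \<gamma>\<^sup>2 = (\<alpha> + \<beta>) * \<gamma> - 1"
    using pos by (auto simp: \<gamma>_def power2_eq_square algebra_simps)
  \<comment> \<open>Division by (q)_(2y) turns the binomial left by the limiting Burge step into the
    kernel of \<open>Bailey_step\<close>.\<close>
  have rr: "1 / qfac q (2 * y) * gbinom_int q (2 * y) (y - c) = inv_qfac q (y - c) * inv_qfac q (y + c)" for c :: int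
  proof (cases "y - c < 0 \<or> y + c < 0")
    case True
    then show ?thesis by (auto simp: inv_qfac_def gbinom_int_eq_0)
  next
    case False
    define u v where "u = nat (y - c)" "v = nat (y + c)"
    then have uv: "y - c = int u" "y + c = int v" "2 * y = u + v" using False by auto
    have "gbinom_int q (2 * y) (y - c) = gbinom q (u + v) u"
      unfolding uv(1) gbinom_int_of_nat[symmetric] using uv(3) by simp
    then show ?thesis unfolding uv by (simp add: inv_qfac_def gbinom_def nz)
  qed
  have IH: "Wsum q ts y (if t then i else y - i) = (\<Sum>j = - int N..int N. alt_sign j * q ^ theta_exp (\<alpha> * \<beta> - 1) j * Burge q (y - i) i (\<delta> * j) (\<gamma> * j))"
    if "i \<le> y" for i
    using Wsum_eq[OF q, of i y N ts] Wsum_eq[OF q, of "y - i" y N ts] 0 that 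
    by (auto simp: slope \<gamma>_def \<delta>_def Burge_swap[of q "int i" "int y - int i"])
  have "Vsum q 0 t ts y = (\<Sum>i\<le>y. 1 / qfac q (2 * y) * q ^ i\<^sup>2 * Wsum q ts y (if t then i else y - i))"
  proof (cases t)
    case False
    define F where "F = (\<lambda>i. 1 / qfac q (2 * y) * q ^ i\<^sup>2 * Wsum q ts y (y - i))"
    have "Vsum q 0 t ts y = (\<Sum>z\<le>y. F (y - z))"
      using False by (auto intro!: sum.cong simp: F_def)
    also have "\<dots> = (\<Sum>i\<le>y. F i)" by (rule sum_flip)
    finally show ?thesis using False by (simp add: F_def)
  qed simp
  also have "\<dots> = (\<Sum>i\<le>y. \<Sum>j = - int N..int N. alt_sign j * q ^ theta_exp (\<alpha> * \<beta> - 1) j * (1 / qfac q (2 * y)) *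
      (q ^ i\<^sup>2 * Burge q (y - i) i (\<delta> * j) (\<gamma> * j)))"
    by (intro sum.cong refl, subst IH) (simp_all add: sum_distrib_left mult_ac)
  also have "\<dots> = (\<Sum>j = - int N..int N. alt_sign j * q ^ theta_exp (\<alpha> * \<beta> - 1) j * (1 / qfac q (2 * y)) *
      (\<Sum>i\<le>y. q ^ i\<^sup>2 * Burge q (y - i) i (\<delta> * j) (\<gamma> * j)))"
    unfolding sum_distrib_left by (rule sum.swap)
  also have "\<dots> = (\<Sum>j = - int N..int N. alt_sign j * q ^ theta_exp ((\<alpha> + \<beta>) * \<gamma> - 1) j * 
     (1 / qfac q (2 * y) * gbinom_int q (2 * y) (y - (\<delta> + \<gamma>) * j)))"
    unfolding k[symmetric] theta_exp_add[symmetric] power_add 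
    using Burge_transform_int(2)[OF q, of y \<delta> _ \<gamma>]
    by (intro sum.cong refl) (simp add: of_nat_diff mult_ac)
  also have "\<delta> + \<gamma> = \<alpha> + \<beta>" by (simp add: \<gamma>_def \<delta>_def)
  finally show ?case unfolding rr by (simp add: slope \<gamma>_def)
next
  case (Suc s)
  define \<alpha> \<beta> where slope: "\<alpha> = fst (slope (t # ts))" "\<beta> = snd (slope (t # ts))"
  have "Vsum q (Suc s) t ts y = (\<Sum>r\<le>y. \<Sum>j = - int N..int N. alt_sign j * q ^ theta_exp (\<alpha> * \<beta> - 1 + s * \<alpha>\<^sup>2) j *
      (q ^ r\<^sup>2 / qfac q (y - r) * (inv_qfac q (int r - \<alpha> * j) * inv_qfac q (int r + \<alpha> * j))))"
    unfolding Vsum.simps slope using Suc.prems 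
    by (intro sum.cong refl, subst Suc.IH) (simp_all add: sum_distrib_left mult_ac del: slope.simps)
  also have "\<dots> = (\<Sum>j = - int N..int N. alt_sign j * q ^ theta_exp (\<alpha> * \<beta> - 1 + s * \<alpha>\<^sup>2) j *
      (\<Sum>r\<le>y. q ^ r\<^sup>2 / qfac q (y - r) * (inv_qfac q (int r - \<alpha> * j) * inv_qfac q (int r + \<alpha> * j))))"
    unfolding sum_distrib_left by (rule sum.swap)
  also have "\<dots> = (\<Sum>j = - int N..int N. alt_sign j * q ^ theta_exp (\<alpha> * \<beta> - 1 + Suc s * \<alpha>\<^sup>2) j *
      (inv_qfac q (int y - \<alpha> * j) * inv_qfac q (int y + \<alpha> * j)))"
  proof (intro sum.cong refl)
    fix j
    have "nat \<bar>int \<alpha> * j\<bar> = \<alpha> * nat \<bar>j\<bar>" by (simp add: nat_mult_distrib abs_mult)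
    moreover have "\<alpha> * \<beta> - 1 + Suc s * \<alpha>\<^sup>2 = \<alpha> * \<beta> - 1 + s * \<alpha>\<^sup>2 + \<alpha>\<^sup>2" by simp
    ultimately show "alt_sign j * q ^ theta_exp (\<alpha> * \<beta> - 1 + s * \<alpha>\<^sup>2) j * (\<Sum>r\<le>y. q ^ r\<^sup>2 / qfac q (y - r) * (inv_qfac q (int r - \<alpha> * j) * inv_qfac q (int r + \<alpha> * j)))
      = alt_sign j * q ^ theta_exp (\<alpha> * \<beta> - 1 + Suc s * \<alpha>\<^sup>2) j * (inv_qfac q (int y - \<alpha> * j) * inv_qfac q (int y + \<alpha> * j))"
      unfolding Bailey_step[OF q] by (simp only: theta_exp_add[symmetric] power_add mult_ac)
  qed
  finally show ?case unfolding slope .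
qed

section \<open>Infinite products, theta series and convergence\<close>

lemma no_root_of_unity_norm:
  fixes q :: "'a::real_normed_field"
  assumes "norm q < 1"
  shows "no_root_of_unity q"
  unfolding no_root_of_unity_def
proof (intro allI impI notI)
  fix n :: nat assume "n > 0" "q ^ n = 1"
  then have "norm q ^ n = 1" by (metis norm_one norm_power)
  then show False using assms \<open>n > 0\<close> power_Suc_less_one[of "norm q" "n - 1"]
    by (cases "norm q = 0") (auto simp: power_0_left)
qed

text \<open>The counterpart of \<open>qpoch_inf\<close> over any complete normed field; the real
  case is needed at |q|.\<close>

definition qprod :: "'a::{real_normed_field,banach} \<Rightarrow> 'a \<Rightarrow> 'a" where
  "qprod x q = (\<Prod>i. 1 - x * q ^ i)"

lemma convergent_qprod:
  fixes q :: "'a::{real_normed_field,banach}"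
  assumes "norm q < 1"
  shows "convergent_prod (\<lambda>i. 1 - x * q ^ i)"
proof (rule abs_convergent_prod_imp_convergent_prod, rule summable_imp_abs_convergent_prod)
  have "summable (\<lambda>i. norm x * norm q ^ i)"
    using assms by (intro summable_mult summable_geometric) auto
  then show "summable (\<lambda>i. norm (1 - x * q ^ i - 1))"
    by (simp add: norm_mult norm_power)
qed

lemma qprod_LIMSEQ:
  fixes q :: "'a::{real_normed_field,banach}"
  assumes "norm q < 1"
  shows "(\<lambda>n. \<Prod>i<n. 1 - x * q ^ i) \<longlonglongrightarrow> qprod x q"
  using convergent_prod_LIMSEQ[OF convergent_qprod[OF assms]]
  unfolding qprod_def LIMSEQ_lessThan_iff_atMost .

lemma qfac_LIMSEQ:
  fixes q :: "'a::{real_normed_field,banach}"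
  assumes "norm q < 1"
  shows "qfac q \<longlonglongrightarrow> qprod q q"
  using qprod_LIMSEQ[OF assms, of q] by (simp add: qfac_def[abs_def])

lemma qprod_self_nonzero:
  fixes q :: "'a::{real_normed_field,banach}"
  assumes "norm q < 1"
  shows "qprod q q \<noteq> 0"
  unfolding qprod_def
proof (rule prodinf_nonzero[OF convergent_qprod[OF assms]])
  show "1 - q * q ^ i \<noteq> 0" for i
    using no_root_of_unity_norm[OF assms] unfolding no_root_of_unity_def by (metis eq_iff_diff_eq_0 power_Suc zero_less_Suc)
qed

lemma inv_qfac_LIMSEQ:
  fixes q :: "'a::{real_normed_field,banach}"
  assumes "norm q < 1"
  shows "(\<lambda>n. inv_qfac q (int n + c)) \<longlonglongrightarrow> 1 / qprod q q"
proof -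
  have 1: "(\<lambda>n. 1 / qfac q n) \<longlonglongrightarrow> 1 / qprod q q"
    by (intro tendsto_divide tendsto_const qfac_LIMSEQ qprod_self_nonzero assms)
  have "filterlim (\<lambda>n. nat (int n + c)) at_top sequentially"
    unfolding filterlim_at_top
  proof
    fix Z
    show "eventually (\<lambda>n. Z \<le> nat (int n + c)) sequentially"
      using eventually_ge_at_top[of "Z + nat \<bar>c\<bar>"] by eventually_elim linarith
  qed
  from filterlim_compose[OF 1 this] show ?thesis
  proof (rule Lim_transform_eventually)
    show "eventually (\<lambda>n. 1 / qfac q (nat (int n + c)) = inv_qfac q (int n + c)) sequentially"
      using eventually_ge_at_top[of "nat \<bar>c\<bar>"] by eventually_elim (auto simp: inv_qfac_def)
  qed
qed

text \<open>Convergent sequences are bounded; the single constant D dominates the terms in every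
  passage to the limit below.\<close>

lemma inv_qfac_bounded:
  fixes q :: "'a::{real_normed_field,banach}"
  assumes "norm q < 1"
  obtains D where "D > 0" "\<And>k. norm (inv_qfac q k) \<le> D" "\<And>n. norm (qfac q n) \<le> D"
proof -
  have "Bseq (\<lambda>n. inv_qfac q (int n + 0))"
    by (rule convergent_imp_Bseq, rule convergentI, rule inv_qfac_LIMSEQ[OF assms])
  moreover have "Bseq (qfac q)"
    by (rule convergent_imp_Bseq, rule convergentI, rule qfac_LIMSEQ[OF assms])
  ultimately
  obtain D1 D2 where D: "D1 > 0" "\<And>n. norm (inv_qfac q (int n)) \<le> D1" "D2 > 0" "\<And>n. norm (qfac q n) \<le> D2"
    unfolding Bseq_def by auto
  have "norm (inv_qfac q k) \<le> max D1 D2" for k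
  proof (cases "k < 0")
    case True
    then show ?thesis using D(1) by (simp add: inv_qfac_def)
  next
    case False
    then show ?thesis using D(2)[of "nat k"] by simp
  qed
  moreover have "norm (qfac q n) \<le> max D1 D2" for n using D(4)[of n] by simp
  ultimately show ?thesis using that[of "max D1 D2"] D(1) by auto
qed

section \<open>Bilateral series and dominated convergence\<close>

definition suminf_int :: "(int \<Rightarrow> 'a::{real_normed_field,banach}) \<Rightarrow> 'a" where
  "suminf_int g = (\<Sum>k. g (int k)) + (\<Sum>k. g (- int (Suc k)))"

lemma sum_int_split:
  fixes f :: "int \<Rightarrow> 'b::comm_monoid_add"
  shows "(\<Sum>j = - int n..int n. f j) = (\<Sum>k\<le>n. f (int k)) + (\<Sum>k<n. f (- int (Suc k)))"
proof -
  have "(\<Sum>j = - int n..int n. f j) = (\<Sum>j\<in>{0..int n} \<union> {- int n..- 1}. f j)"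
    by (rule sum.cong) auto
  also have "\<dots> = (\<Sum>j\<in>{0..int n}. f j) + (\<Sum>j\<in>{- int n..- 1}. f j)"
    by (rule sum.union_disjoint) auto
  also have "(\<Sum>j\<in>{0..int n}. f j) = (\<Sum>k\<le>n. f (int k))"
    by (rule sum.reindex_bij_witness[of _ int nat]) auto
  also have "(\<Sum>j\<in>{- int n..- 1}. f j) = (\<Sum>k<n. f (- int (Suc k)))"
    by (rule sum.reindex_bij_witness[of _ "\<lambda>k. - int (Suc k)" "\<lambda>j. nat (- j - 1)"]) auto
  finally show ?thesis .
qed

text \<open>Extension by 0 outside \<open>A n\<close> turns the finite sums into full series, to
  which \<open>tannerys_theorem\<close> applies.\<close>

lemma Tannery_sum:
  fixes f :: "nat \<Rightarrow> nat \<Rightarrow> 'a::{real_normed_field,banach}"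
  assumes "\<And>k. (\<lambda>n. f n k) \<longlonglongrightarrow> g k" and "\<And>n k. norm (f n k) \<le> B k" and "summable B"
    and "\<And>k. eventually (\<lambda>n. k \<in> A n) sequentially" and "\<And>n. finite (A n)"
  shows "(\<lambda>n. \<Sum>k\<in>A n. f n k) \<longlonglongrightarrow> (\<Sum>k. g k)" "summable (\<lambda>k. norm (g k))"
proof -
  let ?a = "\<lambda>k n. if k \<in> A n then f n k else 0"
  have B: "norm (?a k n) \<le> B k" for k n
    using assms(2)[of n k] order_trans[OF norm_ge_zero assms(2)] by auto
  have lim: "(\<lambda>n. ?a k n) \<longlonglongrightarrow> g k" for k
    using assms(1)[of k] by (rule Lim_transform_eventually) (use assms(4)[of k] in eventually_elim, simp)
  have bnd: "eventually (\<lambda>(k, n). norm (?a k n) \<le> B k) (at_top \<times>\<^sub>F sequentially)"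
    using B by (intro always_eventually) auto
  have "(\<lambda>n. \<Sum>k. ?a k n) \<longlonglongrightarrow> suminf g \<and> summable (\<lambda>k. norm (g k))"
    using tannerys_theorem[of ?a g sequentially B, OF lim bnd assms(3) sequentially_bot] by blast
  moreover have "(\<Sum>k. ?a k n) = (\<Sum>k\<in>A n. f n k)" for n
    by (subst suminf_finite[of "A n"]) (use assms(5) in auto)
  ultimately show "(\<lambda>n. \<Sum>k\<in>A n. f n k) \<longlonglongrightarrow> (\<Sum>k. g k)" "summable (\<lambda>k. norm (g k))" by auto
qed

lemma Tannery_int:
  fixes f :: "nat \<Rightarrow> int \<Rightarrow> 'a::{real_normed_field,banach}"
  assumes lim: "\<And>j. (\<lambda>n. f n j) \<longlonglongrightarrow> g j"
    and bound: "\<And>n j. norm (f n j) \<le> M * r ^ nat \<bar>j\<bar>" and r: "0 \<le> r" "r < 1"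
  shows "(\<lambda>n. \<Sum>j = - int n..int n. f n j) \<longlonglongrightarrow> suminf_int g"
  unfolding sum_int_split suminf_int_def
proof (rule tendsto_add)
  have S: "summable (\<lambda>k. M * r ^ k)" "summable (\<lambda>k. M * r ^ Suc k)"
    using r by (auto intro!: summable_mult summable_geometric simp del: power_Suc simp: summable_Suc_iff)
  have ev: "eventually (\<lambda>n. k \<in> {..n}) sequentially" "eventually (\<lambda>n. k \<in> {..<n}) sequentially" for k :: nat
    using eventually_ge_at_top[of k] eventually_gt_at_top[of k] by auto
  show "(\<lambda>n. \<Sum>k\<le>n. f n (int k)) \<longlonglongrightarrow> (\<Sum>k. g (int k))"
    by (rule Tannery_sum[OF lim _ S(1) ev(1)]) (use bound[of _ "int _"] in auto)
  show "(\<lambda>n. \<Sum>k<n. f n (- int (Suc k))) \<longlonglongrightarrow> (\<Sum>k. g (- int (Suc k)))"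
  proof (rule Tannery_sum[OF lim _ S(2) ev(2)])
    show "norm (f n (- int (Suc k))) \<le> M * r ^ Suc k" for n k
    proof -
      have "nat \<bar>- int (Suc k)\<bar> = Suc k" by simp
      then show ?thesis using bound[of n "- int (Suc k)"] by metis
    qed
  qed auto
qed

section \<open>Theta series and the Jacobi triple product\<close>

definition theta :: "'a::{real_normed_field,banach} \<Rightarrow> nat \<Rightarrow> 'a" where
  "theta q K = suminf_int (\<lambda>j. alt_sign j * q ^ theta_exp K j)"

lemma norm_alt_sign [simp]: "norm (alt_sign j :: 'a::real_normed_field) = 1"
  by (simp add: alt_sign_def norm_power)

text \<open>This yields the geometric majorant |q|^|j|. Positivity of K matters: for K = 0 the
  exponent at j = 1 is 0.\<close>

lemma theta_exp_ge: "K > 0 \<Longrightarrow> nat \<bar>j\<bar> \<le> theta_exp K j"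
proof -
  assume "K > 0"
  have "nat \<bar>j\<bar> \<le> (nat \<bar>j\<bar>)\<^sup>2"
    unfolding power2_eq_square by (rule le_square)
  also have "\<dots> \<le> K * (nat \<bar>j\<bar>)\<^sup>2" using \<open>K > 0\<close> by simp
  finally show ?thesis by (simp add: theta_exp_def)
qed

lemma norm_theta_term:
  fixes q :: "'a::real_normed_field"
  assumes "norm q < 1" "K > 0" "norm z \<le> M"
  shows "norm (alt_sign j * q ^ theta_exp K j * z) \<le> M * norm q ^ nat \<bar>j\<bar>"
proof -
  have "norm q ^ theta_exp K j \<le> norm q ^ nat \<bar>j\<bar>"
    using assms by (intro power_decreasing theta_exp_ge) auto
  then have "norm q ^ theta_exp K j * norm z \<le> norm q ^ nat \<bar>j\<bar> * M"
    using assms by (intro mult_mono) auto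
  then show ?thesis by (simp add: norm_mult norm_power mult.commute)
qed

lemma suminf_int_theta:
  fixes q :: "'a::{real_normed_field,banach}"
  assumes "norm q < 1" "K > 0"
  shows "suminf_int (\<lambda>j. alt_sign j * q ^ theta_exp K j * c) = theta q K * c"
proof -
  have L: "(\<lambda>n. \<Sum>j = - int n..int n. alt_sign j * q ^ theta_exp K j * z) \<longlonglongrightarrow> suminf_int (\<lambda>j. alt_sign j * q ^ theta_exp K j * z)" for z
    using assms by (intro Tannery_int[where M = "norm z" and r = "norm q"] norm_theta_term) auto
  have "(\<Sum>j = - int n..int n. alt_sign j * q ^ theta_exp K j * 1) * c = (\<Sum>j = - int n..int n. alt_sign j * q ^ theta_exp K j * c)" for n
    by (simp only: sum_distrib_right mult_1_right)
  with tendsto_mult_right[OF L[of 1], of c]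
  have "(\<lambda>n. \<Sum>j = - int n..int n. alt_sign j * q ^ theta_exp K j * c) \<longlonglongrightarrow> theta q K * c"
    by (simp only: theta_def mult_1_right)
  with L[of c] show ?thesis by (rule LIMSEQ_unique)
qed

text \<open>Let n tend to infinity in \<open>finite_Jacobi_triple\<close> with p = q^(2m-1). The
  binomial [2n; n+j] at p is bounded uniformly and tends to 1/(p;p)_inf, which accounts for the
  third factor on the right.\<close>

lemma Jacobi_triple_product:
  fixes q :: "'a::{real_normed_field,banach}"
  assumes q: "norm q < 1" and m: "m > 1"
  shows "theta q (m - 1) = qprod (q ^ (m - 1)) (q ^ (2 * m - 1)) * qprod (q ^ m) (q ^ (2 * m - 1))
    * qprod (q ^ (2 * m - 1)) (q ^ (2 * m - 1))"
proof -
  define p where "p = q ^ (2 * m - 1)"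
  have p: "norm p < 1"
  proof -
    have "norm q ^ (2 * m - 1) \<le> norm q ^ 1"
      using q m by (intro power_decreasing) auto
    then show ?thesis using q by (simp add: p_def norm_power)
  qed
  obtain D where D: "D > 0" "\<And>k. norm (inv_qfac p k) \<le> D" "\<And>n. norm (qfac p n) \<le> D"
    using inv_qfac_bounded[OF p] by blast
  have nz: "qprod p p \<noteq> 0" by (rule qprod_self_nonzero[OF p])
  let ?F = "\<lambda>n j. alt_sign j * q ^ theta_exp (m - 1) j * (qfac p (2 * n) * inv_qfac p (int n + j) * inv_qfac p (int n + - j))"
  have fin: "(\<Sum>j = - int n..int n. ?F n j) = (\<Prod>i<n. 1 - q ^ (m - 1) * p ^ i) * (\<Prod>i<n. 1 - q ^ m * p ^ i)" for n
  proof -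
    have "gbinom_int p (2 * int n) (int n + j) = qfac p (2 * n) * inv_qfac p (int n + j) * inv_qfac p (int n + - j)"
      if "j \<in> {- int n..int n}" for j
    proof -
      define u v where "u = nat (int n + j)" "v = nat (int n - j)"
      have uv: "int n + j = int u" "int n - j = int v" "2 * n = u + v" using that by (auto simp: u_v_def)
      have "gbinom_int p (2 * int n) (int n + j) = gbinom p (u + v) u"
        unfolding uv(1) gbinom_int_of_nat[symmetric] using uv(3) by (metis of_nat_mult of_nat_numeral)
      then have "gbinom_int p (2 * int n) (int n + j) = qfac p (2 * n) * inv_qfac p (int u) * inv_qfac p (int v)"
        by (simp add: gbinom_def inv_qfac_def uv(3))
      moreover have "int n + - j = int v" using uv(2) by simp
      ultimately show ?thesis by (simp only: uv(1))
    qed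
    then have "(\<Sum>j = - int n..int n. ?F n j) = (\<Sum>j = - int n..int n. jacobi_term (q ^ (m - 1)) (q ^ m) p j * gbinom_int p (2 * int n) (int n + j))"
      using jacobi_term_power(2)[of m q] m by (intro sum.cong) (auto simp: p_def)
    then show ?thesis
      using finite_Jacobi_triple[OF no_root_of_unity_norm[OF p], of "q ^ (m - 1)" "q ^ m"] jacobi_term_power(1)[of m q] m by (simp add: p_def)
  qed
  have "(\<lambda>n. \<Sum>j = - int n..int n. ?F n j) \<longlonglongrightarrow> suminf_int (\<lambda>j. alt_sign j * q ^ theta_exp (m - 1) j * (1 / qprod p p))"
  proof (rule Tannery_int[where M = "D * D * D" and r = "norm q"])
    fix j
    have "(\<lambda>n. qfac p (2 * n)) \<longlonglongrightarrow> qprod p p"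
      by (rule filterlim_compose[OF qfac_LIMSEQ[OF p]]) (rule filterlim_subseq, simp add: strict_mono_def)
    then have "(\<lambda>n. ?F n j) \<longlonglongrightarrow> alt_sign j * q ^ theta_exp (m - 1) j * (qprod p p * (1 / qprod p p) * (1 / qprod p p))"
      by (intro tendsto_mult tendsto_const inv_qfac_LIMSEQ[OF p])
    then show "(\<lambda>n. ?F n j) \<longlonglongrightarrow> alt_sign j * q ^ theta_exp (m - 1) j * (1 / qprod p p)"
      using nz by simp
  next
    fix n j
    have "norm (qfac p (2 * n) * inv_qfac p (int n + j) * inv_qfac p (int n + - j)) \<le> D * D * D"
      unfolding norm_mult using D by (intro mult_mono mult_nonneg_nonneg) (auto simp: less_imp_le)
    then show "norm (?F n j) \<le> D * D * D * norm q ^ nat \<bar>j\<bar>"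
      using q m by (intro norm_theta_term) auto
  qed (use q in auto)
  moreover have "(\<lambda>n. \<Sum>j = - int n..int n. ?F n j) \<longlonglongrightarrow> qprod (q ^ (m - 1)) p * qprod (q ^ m) p"
    unfolding fin by (intro tendsto_mult qprod_LIMSEQ p)
  ultimately have E: "suminf_int (\<lambda>j. alt_sign j * q ^ theta_exp (m - 1) j * (1 / qprod p p)) = qprod (q ^ (m - 1)) p * qprod (q ^ m) p"
    by (rule LIMSEQ_unique)
  have "theta q (m - 1) * (1 / qprod p p) = qprod (q ^ (m - 1)) p * qprod (q ^ m) p"
    unfolding E[symmetric] using q m by (intro suminf_int_theta[symmetric]) auto
  then show ?thesis using nz unfolding p_def[symmetric] by (simp add: field_simps)
qed

section \<open>Limits of the multisums\<close>

definition theta_index :: "nat \<Rightarrow> bool \<Rightarrow> bool list \<Rightarrow> nat" where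
  "theta_index s t ts = fst (slope (t # ts)) * snd (slope (t # ts)) - 1 + s * (fst (slope (t # ts)))\<^sup>2"

lemma theta_index_pos: "theta_index s t ts > 0"
proof -
  have "fst (slope (t # ts)) \<ge> 2" using slope_pos[of ts] by simp
  moreover have "snd (slope (t # ts)) \<ge> 1" using slope_pos(2)[of "t # ts"] by simp
  ultimately have "2 * 1 \<le> fst (slope (t # ts)) * snd (slope (t # ts))" by (rule mult_le_mono)
  then show ?thesis unfolding theta_index_def by linarith
qed

text \<open>By \<open>Vsum_eq\<close> there are 2y + 1 terms, each of norm at most a constant.
  Linear growth suffices, since the factor q^(r^2) in \<open>Vsum_sums\<close> outweighs it.\<close>

lemma Vsum_bound:
  fixes q :: "'a::{real_normed_field,banach}"
  assumes "norm q < 1"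
  obtains D where "D > 0" "\<And>y. norm (Vsum q s t ts y) \<le> D * real (Suc y)"
proof -
  obtain D where D: "D > 0" "\<And>k. norm (inv_qfac q k) \<le> D" "\<And>n. norm (qfac q n) \<le> D"
    using inv_qfac_bounded[OF assms] by blast
  have "norm (Vsum q s t ts y) \<le> 2 * (D * D) * real (Suc y)" for y
  proof -
    let ?a = "fst (slope (t # ts))"
    have "norm (Vsum q s t ts y) \<le> (\<Sum>j = - int y..int y. D * D)"
      unfolding Vsum_eq[OF no_root_of_unity_norm[OF assms] order_refl] theta_index_def[symmetric]
    proof (rule sum_norm_le)
      fix j :: int
      have "norm (inv_qfac q (int y - ?a * j) * inv_qfac q (int y + ?a * j)) \<le> D * D"
        unfolding norm_mult using D by (intro mult_mono) (auto simp: less_imp_le)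
      then have "norm (alt_sign j * q ^ theta_exp (theta_index s t ts) j * (inv_qfac q (int y - ?a * j) * inv_qfac q (int y + ?a * j))) \<le> D * D * norm q ^ nat \<bar>j\<bar>"
        by (rule norm_theta_term[OF assms theta_index_pos])
      also have "\<dots> \<le> D * D * 1"
        using assms D(1) by (intro mult_left_mono power_le_one) auto
      finally show "norm (alt_sign j * q ^ theta_exp (theta_index s t ts) j * (inv_qfac q (int y - ?a * j) * inv_qfac q (int y + ?a * j))) \<le> D * D" by simp
    qed
    also have "\<dots> = (2 * real y + 1) * (D * D)" by simp
    also have "\<dots> \<le> 2 * (D * D) * real (Suc y)" using D(1) by (simp add: algebra_simps)
    finally show ?thesis .
  qed
  then show ?thesis using that[of "2 * (D * D)"] D(1) by simp
qed

lemma Vsum_LIMSEQ: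
  fixes q :: "'a::{real_normed_field,banach}"
  assumes q: "norm q < 1"
  shows "Vsum q s t ts \<longlonglongrightarrow> theta q (theta_index s t ts) / (qprod q q)\<^sup>2"
proof -
  obtain D where D: "D > 0" "\<And>k. norm (inv_qfac q k) \<le> D" "\<And>n. norm (qfac q n) \<le> D"
    using inv_qfac_bounded[OF assms] by blast
  let ?a = "fst (slope (t # ts))" and ?K = "theta_index s t ts"
  let ?F = "\<lambda>(n::nat) (j::int). alt_sign j * q ^ theta_exp ?K j * (inv_qfac q (int n + (- (?a * j))) * inv_qfac q (int n + ?a * j))"
  let ?c = "1 / qprod q q * (1 / qprod q q)"
  have "(\<lambda>n. \<Sum>j = - int n..int n. ?F n j) \<longlonglongrightarrow> suminf_int (\<lambda>j. alt_sign j * q ^ theta_exp ?K j * ?c)"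
  proof (rule Tannery_int[where M = "D * D" and r = "norm q"])
    show "(\<lambda>n. ?F n j) \<longlonglongrightarrow> alt_sign j * q ^ theta_exp ?K j * ?c" for j
      by (intro tendsto_mult tendsto_const inv_qfac_LIMSEQ[OF q])
    fix n and j :: int
    have "norm (inv_qfac q (int n + (- (?a * j))) * inv_qfac q (int n + ?a * j)) \<le> D * D"
      unfolding norm_mult using D by (intro mult_mono) (auto simp: less_imp_le)
    then show "norm (?F n j) \<le> D * D * norm q ^ nat \<bar>j\<bar>"
      by (rule norm_theta_term[OF q theta_index_pos])
  qed (use q in auto)
  moreover have "(\<Sum>j = - int n..int n. ?F n j) = Vsum q s t ts n" for n
    unfolding Vsum_eq[OF no_root_of_unity_norm[OF q] order_refl] theta_index_def by simp
  ultimately have 1: "Vsum q s t ts \<longlonglongrightarrow> suminf_int (\<lambda>j. alt_sign j * q ^ theta_exp ?K j * ?c)" by simp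
  have "suminf_int (\<lambda>j. alt_sign j * q ^ theta_exp ?K j * ?c) = theta q ?K * ?c"
    by (intro suminf_int_theta q theta_index_pos)
  with 1 show ?thesis by (simp add: power2_eq_square)
qed

text \<open>The limit of \<open>Vsum q (Suc s) t ts n\<close> is computed twice. By its definition
  and dominated convergence it is the series over r divided by (q;q)_inf; by
  \<open>Vsum_LIMSEQ\<close> it is the theta series divided by the square of (q;q)_inf. Hence the
  outermost infinite sum acts as one more Bailey step, and the index is
  \<open>Suc s\<close>.\<close>

lemma Vsum_sums:
  fixes q :: "'a::{real_normed_field,banach}"
  assumes q: "norm q < 1"
  shows "summable (\<lambda>r. norm (q ^ r\<^sup>2 * Vsum q s t ts r))"
    "(\<lambda>r. q ^ r\<^sup>2 * Vsum q s t ts r) sums (theta q (theta_index (Suc s) t ts) / qprod q q)"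
proof -
  obtain D where D: "D > 0" "\<And>k. norm (inv_qfac q k) \<le> D" "\<And>n. norm (qfac q n) \<le> D"
    using inv_qfac_bounded[OF assms] by blast
  obtain E where E: "E > 0" "\<And>y. norm (Vsum q s t ts y) \<le> E * real (Suc y)" using Vsum_bound[OF assms] by blast
  have nz: "qprod q q \<noteq> 0" by (rule qprod_self_nonzero[OF q])
  let ?c = "1 / qprod q q"
  let ?f = "\<lambda>n r. q ^ r\<^sup>2 * inv_qfac q (int n + (- int r)) * Vsum q s t ts r"
  let ?B = "\<lambda>r. D * E * (real (Suc r) * norm q ^ r)"
  have B: "norm (?f n r) \<le> ?B r" for n r
  proof -
    have "norm q ^ r\<^sup>2 \<le> norm q ^ r"
      using q by (intro power_decreasing) (auto simp: power2_eq_square)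
    then have "norm q ^ r\<^sup>2 * norm (inv_qfac q (int n + (- int r))) * norm (Vsum q s t ts r) \<le> norm q ^ r * D * (E * real (Suc r))"
      using D E by (intro mult_mono mult_nonneg_nonneg) (auto simp: less_imp_le)
    then show ?thesis by (simp add: norm_mult norm_power mult_ac)
  qed
  have S: "summable ?B"
    using geometric_deriv_sums[of "norm q"] q by (intro summable_mult) (auto simp: sums_iff)
  have lim: "(\<lambda>n. ?f n r) \<longlonglongrightarrow> q ^ r\<^sup>2 * ?c * Vsum q s t ts r" for r
    by (intro tendsto_mult tendsto_const inv_qfac_LIMSEQ[OF q])
  have ev: "eventually (\<lambda>n. k \<in> {..n}) sequentially" for k :: nat
    using eventually_ge_at_top[of k] by auto
  have T: "(\<lambda>n. \<Sum>r\<le>n. ?f n r) \<longlonglongrightarrow> (\<Sum>r. q ^ r\<^sup>2 * ?c * Vsum q s t ts r)" "summable (\<lambda>r. norm (q ^ r\<^sup>2 * ?c * Vsum q s t ts r))"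
    using Tannery_sum[OF lim B S ev] by auto
  have X: "(\<Sum>r\<le>n. ?f n r) = Vsum q (Suc s) t ts n" for n
  proof -
    have "inv_qfac q (int n + (- int r)) = 1 / qfac q (n - r)" if "r \<le> n" for r
      using that by (simp add: inv_qfac_def nat_diff_distrib)
    then show ?thesis unfolding Vsum.simps by (intro sum.cong) auto
  qed
  have "Vsum q (Suc s) t ts \<longlonglongrightarrow> (\<Sum>r. q ^ r\<^sup>2 * ?c * Vsum q s t ts r)"
    using T(1) unfolding X .
  then have L: "(\<Sum>r. q ^ r\<^sup>2 * ?c * Vsum q s t ts r) = theta q (theta_index (Suc s) t ts) / (qprod q q)\<^sup>2"
    using Vsum_LIMSEQ[OF q] LIMSEQ_unique by blast
  have "summable (\<lambda>r. norm (qprod q q) * norm (q ^ r\<^sup>2 * ?c * Vsum q s t ts r))"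
    by (intro summable_mult T(2))
  then show S: "summable (\<lambda>r. norm (q ^ r\<^sup>2 * Vsum q s t ts r))"
    using nz by (simp add: norm_mult norm_divide)
  have "(\<lambda>r. qprod q q * (q ^ r\<^sup>2 * ?c * Vsum q s t ts r)) sums (qprod q q * (theta q (theta_index (Suc s) t ts) / (qprod q q)\<^sup>2))"
    unfolding L[symmetric] by (intro sums_mult summable_sums summable_norm_cancel[OF T(2)])
  then show "(\<lambda>r. q ^ r\<^sup>2 * Vsum q s t ts r) sums (theta q (theta_index (Suc s) t ts) / qprod q q)"
    using nz by (simp add: power2_eq_square)
qed

section \<open>Unfolding the nested sums into single terms\<close>

primrec descents :: "nat \<Rightarrow> nat \<Rightarrow> nat list set" where
  "descents 0 y = {[]}"
| "descents (Suc n) y = (\<Union>z\<le>y. (#) z ` descents n z)"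

lemma finite_descents [simp]: "finite (descents n y)"
  by (induction n arbitrary: y) auto

lemma sum_descents_Suc:
  fixes f :: "nat list \<Rightarrow> 'b::comm_monoid_add"
  shows "(\<Sum>zs\<in>descents (Suc n) y. f zs) = (\<Sum>z\<le>y. \<Sum>zs\<in>descents n z. f (z # zs))"
proof -
  have "(\<Sum>zs\<in>descents (Suc n) y. f zs) = (\<Sum>z\<le>y. \<Sum>zs\<in>(#) z ` descents n z. f zs)"
    unfolding descents.simps by (rule sum.UNION_disjoint) auto
  also have "\<dots> = (\<Sum>z\<le>y. \<Sum>zs\<in>descents n z. f (z # zs))"
  proof (rule sum.cong[OF refl])
    fix z
    have "inj_on ((#) z) (descents n z)" by (auto simp: inj_on_def)
    from sum.reindex[OF this, of f] show "sum f ((#) z ` descents n z) = (\<Sum>zs\<in>descents n z. f (z # zs))"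
      by (simp add: o_def)
  qed
  finally show ?thesis .
qed

text \<open>The term of \<open>Wsum\<close> at one tuple of nested summation indices. The last
  clause only concerns lists of the wrong length, which do not occur in
  \<open>descents (length ts) y\<close>.\<close>

fun Wweight :: "'a::field \<Rightarrow> bool list \<Rightarrow> nat \<Rightarrow> nat \<Rightarrow> nat list \<Rightarrow> 'a" where
  "Wweight q [] x y [] = q ^ (y * (x - y)) * gbinom q x y"
| "Wweight q (t # ts) x y (z # zs) = q ^ (if t then z else y - z)\<^sup>2 * gbinom q (x + (if t then y - z else z)) (2 * y) * Wweight q ts y z zs"
| "Wweight q _ _ _ _ = 0"

fun Vweight :: "'a::field \<Rightarrow> nat \<Rightarrow> bool \<Rightarrow> bool list \<Rightarrow> nat \<Rightarrow> nat list \<Rightarrow> 'a" where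
  "Vweight q 0 t ts y (z # zs) = 1 / qfac q (2 * y) * q ^ (if t then z else y - z)\<^sup>2 * Wweight q ts y z zs"
| "Vweight q (Suc s) t ts y (z # zs) = q ^ z\<^sup>2 / qfac q (y - z) * Vweight q s t ts z zs"
| "Vweight q _ _ _ _ [] = 0"

lemma sum_Wweight: "(\<Sum>zs\<in>descents (length ts) y. Wweight q ts x y zs) = Wsum q ts x y"
  by (induction ts arbitrary: x y) (simp_all add: sum_descents_Suc flip: sum_distrib_left del: descents.simps(2))

lemma sum_Vweight: "(\<Sum>zs\<in>descents (s + Suc (length ts)) y. Vweight q s t ts y zs) = Vsum q s t ts y"
proof (induction s arbitrary: y)
  case 0
  have "(\<Sum>zs\<in>descents (0 + Suc (length ts)) y. Vweight q 0 t ts y zs)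
    = (\<Sum>z\<le>y. \<Sum>zs\<in>descents (length ts) z. 1 / qfac q (2 * y) * q ^ (if t then z else y - z)\<^sup>2 * Wweight q ts y z zs)"
    by (simp only: add_0 sum_descents_Suc Vweight.simps)
  then show ?case by (simp only: sum_distrib_left[symmetric] sum_Wweight Vsum.simps)
next
  case (Suc s)
  have "(\<Sum>zs\<in>descents (Suc s + Suc (length ts)) y. Vweight q (Suc s) t ts y zs)
    = (\<Sum>z\<le>y. \<Sum>zs\<in>descents (s + Suc (length ts)) z. q ^ z\<^sup>2 / qfac q (y - z) * Vweight q s t ts z zs)"
    by (simp only: add_Suc sum_descents_Suc Vweight.simps)
  then show ?case by (simp only: sum_distrib_left[symmetric] Suc.IH Vsum.simps)
qed

section \<open>Majorants at |q|\<close>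

lemma norm_inverse_qfac:
  fixes q :: "'a::real_normed_field"
  assumes "norm q < 1"
  shows "norm (1 / qfac q n) \<le> 1 / qfac (norm q) n" "qfac (norm q) n > 0"
proof -
  have pos: "1 - norm q ^ Suc i > 0" for i
    using power_Suc_less_one[of "norm q" i] assms by (cases "norm q = 0") auto
  show "qfac (norm q) n > 0" unfolding qfac_def by (intro prod_pos) (use pos in blast)
  moreover have "qfac (norm q) n \<le> norm (qfac q n)"
    unfolding qfac_def prod_norm[symmetric]
  proof (intro prod_mono conjI)
    fix i
    show "0 \<le> 1 - norm q ^ Suc i" using pos[of i] by simp
    show "1 - norm q ^ Suc i \<le> norm (1 - q ^ Suc i)"
      using norm_triangle_ineq2[of 1 "q ^ Suc i"] by (simp add: norm_power norm_mult)
  qed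
  ultimately show "norm (1 / qfac q n) \<le> 1 / qfac (norm q) n"
    by (simp add: norm_divide frac_le)
qed

text \<open>Pascal's rule has coefficients 1 and a power of q, so the triangle inequality passes
  through the recursion. Bounding numerator and denominator separately would not give this.\<close>

lemma norm_gbinom:
  fixes q :: "'a::real_normed_field"
  assumes "norm q < 1"
  shows "norm (gbinom q n k) \<le> gbinom (norm q) n k"
proof (induction n arbitrary: k)
  case 0
  then show ?case by (simp add: gbinom_0_left)
next
  case (Suc n)
  have g: "no_root_of_unity q" "no_root_of_unity (norm q)" using assms by (auto intro!: no_root_of_unity_norm)
  show ?case
  proof (cases k)
    case 0
    then show ?thesis using g by (simp add: gbinom_0_right)
  next
    case (Suc k')
    have "norm (gbinom q n (Suc k') + q ^ (n - k') * gbinom q n k') \<le> norm (gbinom q n (Suc k')) + norm q ^ (n - k') * norm (gbinom q n k')"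
      using norm_triangle_ineq by (metis norm_mult norm_power)
    also have "\<dots> \<le> gbinom (norm q) n (Suc k') + norm q ^ (n - k') * gbinom (norm q) n k'"
      by (intro add_mono mult_left_mono Suc.IH) auto
    finally show ?thesis unfolding Suc gbinom_Suc_Suc[OF g(1)] gbinom_Suc_Suc[OF g(2)] .
  qed
qed

lemma norm_Wweight:
  fixes q :: "'a::real_normed_field"
  assumes "norm q < 1"
  shows "norm (Wweight q ts x y zs) \<le> Wweight (norm q) ts x y zs"
proof (induction ts arbitrary: x y zs)
  case Nil
  then show ?case
    by (cases zs) (auto simp: norm_mult norm_power intro!: mult_left_mono norm_gbinom[OF assms])
next
  case (Cons t ts)
  have g: "0 \<le> gbinom (norm q) n k" for n k
    by (rule order_trans[OF norm_ge_zero norm_gbinom[OF assms]])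
  show ?case
  proof (cases zs)
    case (Cons z zs')
    show ?thesis unfolding Cons Wweight.simps norm_mult norm_power
      by (intro mult_mono mult_nonneg_nonneg norm_gbinom assms Cons.IH g zero_le_power norm_ge_zero order_refl)
  qed simp
qed

lemma norm_Vweight:
  fixes q :: "'a::real_normed_field"
  assumes "norm q < 1"
  shows "norm (Vweight q s t ts y zs) \<le> Vweight (norm q) s t ts y zs"
proof (induction s arbitrary: y zs)
  case 0
  show ?case
  proof (cases zs)
    case (Cons z zs')
    show ?thesis unfolding Cons Vweight.simps norm_mult norm_power
      using norm_inverse_qfac[OF assms]
      by (intro mult_mono mult_nonneg_nonneg norm_Wweight assms zero_le_power norm_ge_zero order_refl) (auto simp: less_imp_le)
  qed simp
next
  case (Suc s)
  show ?case
  proof (cases zs)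
    case (Cons z zs')
    have "norm q ^ z\<^sup>2 * norm (1 / qfac q (y - z)) * norm (Vweight q s t ts z zs')
      \<le> norm q ^ z\<^sup>2 * (1 / qfac (norm q) (y - z)) * Vweight (norm q) s t ts z zs'"
      using norm_inverse_qfac[OF assms]
      by (intro mult_mono mult_nonneg_nonneg Suc.IH zero_le_power norm_ge_zero order_refl) (auto simp: less_imp_le)
    then show ?thesis unfolding Cons by (simp add: norm_mult norm_divide norm_power)
  qed simp
qed

lemma has_sum_Vweight:
  fixes q :: complex
  assumes q: "norm q < 1"
  shows "((\<lambda>(y, zs). q ^ y\<^sup>2 * Vweight q s t ts y zs) has_sum (theta q (theta_index (Suc s) t ts) / qprod q q))
    (Sigma UNIV (descents (s + Suc (length ts))))"
proof (rule has_sum_SigmaI)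
  let ?n = "s + Suc (length ts)" and ?r = "norm q"
  \<comment> \<open>Stated for an arbitrary normed field because it is used at the complex q and at
    the real |q|.\<close>
  have fin: "((\<lambda>zs. q ^ y\<^sup>2 * Vweight q s t ts y zs) has_sum (q ^ y\<^sup>2 * Vsum q s t ts y)) (descents ?n y)" for q :: "'b::real_normed_field" and y
    using has_sum_finite[OF finite_descents[of ?n y], of "\<lambda>zs. q ^ y\<^sup>2 * Vweight q s t ts y zs"]
    by (simp only: sum_distrib_left[symmetric] sum_Vweight)
  show "((\<lambda>zs. case (y, zs) of (y, zs) \<Rightarrow> q ^ y\<^sup>2 * Vweight q s t ts y zs) has_sum (q ^ y\<^sup>2 * Vsum q s t ts y)) (descents ?n y)" for y
    using fin[of q y] by simp
  show "((\<lambda>y. q ^ y\<^sup>2 * Vsum q s t ts y) has_sum theta q (theta_index (Suc s) t ts) / qprod q q) UNIV"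
    by (rule norm_summable_imp_has_sum) (rule Vsum_sums[OF q])+
  \<comment> \<open>At |q| the terms are nonnegative, so summability of the inner totals already
    gives summability over all pairs.\<close>
  have "(\<lambda>(y, zs). ?r ^ y\<^sup>2 * Vweight ?r s t ts y zs) summable_on Sigma UNIV (descents ?n)"
  proof (rule summable_on_SigmaI)
    show "((\<lambda>zs. case (y, zs) of (y, zs) \<Rightarrow> ?r ^ y\<^sup>2 * Vweight ?r s t ts y zs) has_sum (?r ^ y\<^sup>2 * Vsum ?r s t ts y)) (descents ?n y)" for y
      using fin[of ?r y] by simp
    have "norm ?r < 1" using q by simp
    from norm_summable_imp_has_sum[OF Vsum_sums[OF this]]
    show "(\<lambda>y. ?r ^ y\<^sup>2 * Vsum ?r s t ts y) summable_on UNIV"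
      using has_sum_imp_summable by blast
    show "0 \<le> (case (y, zs) of (y, zs) \<Rightarrow> ?r ^ y\<^sup>2 * Vweight ?r s t ts y zs)" for y zs
      using order_trans[OF norm_ge_zero norm_Vweight[OF q]] by simp
  qed
  then have "(\<lambda>x. norm (case x of (y, zs) \<Rightarrow> q ^ y\<^sup>2 * Vweight q s t ts y zs)) summable_on Sigma UNIV (descents ?n)"
    by (rule Infinite_Sum.abs_summable_on_comparison_test')
      (auto simp: norm_mult norm_power intro!: mult_left_mono norm_Vweight[OF q])
  then show "(\<lambda>(y, zs). q ^ y\<^sup>2 * Vweight q s t ts y zs) summable_on Sigma UNIV (descents ?n)"
    by (rule Infinite_Sum.abs_summable_summable)
qed

section \<open>Continued fractions and the quadratic form\<close>

text \<open>One letter for each of the rows 1, ..., d - 1, True at the partial sums t_j below d. Row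
  d also lies in \<open>Tset\<close> but gets no letter: it yields the starting identity, which is
  why the last quotient contributes x - 1 letters.\<close>

fun steps :: "nat list \<Rightarrow> bool list" where
  "steps [] = []"
| "steps [x] = replicate (x - 1) False"
| "steps (x # y # ys) = replicate (x - 1) False @ True # steps (y # ys)"

lemma Tset_Cons: "Tset (x # xs) = insert x ((+) x ` Tset xs)"
proof -
  have T: "Tset ys = tt ys ` {1..length ys}" for ys
    by (auto simp: Tset_def)
  have "{1..length (x # xs)} = Suc ` {0..length xs}" by (simp add: image_Suc_atLeastAtMost)
  moreover have "{0..length xs} = insert 0 {1..length xs}" by auto
  ultimately show ?thesis by (simp only: T image_image image_insert) (simp add: tt_def)
qed

lemma Tset_Nil: "Tset [] = {}"
  by (auto simp: Tset_def)

lemma map_upt_shift: "map f [x + a..<x + b] = map (\<lambda>i. f (x + i)) [a..<b]"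
  by (rule nth_equalityI) (auto simp: add.assoc)

text \<open>The second claim serves the case a > 2b: the variables n_i replace the first a_0 rows,
  and the remaining rows spell the continued fraction without its first quotient.\<close>

lemma map_Tset_eq_steps:
  assumes "\<forall>x\<in>set xs. 1 \<le> x" "xs \<noteq> []"
  shows "map (\<lambda>j. j \<in> Tset xs) [1..<dd xs] = steps xs"
    "tl xs \<noteq> [] \<Longrightarrow> map (\<lambda>j. j \<in> Tset xs) [hd xs + 1..<dd xs] = steps (tl xs)"
proof -
  have tail: "map (\<lambda>j. j \<in> Tset (x # xs)) [x + 1..<x + dd xs] = map (\<lambda>j. j \<in> Tset xs) [1..<dd xs]" for x xs
    unfolding map_upt_shift by (auto simp: Tset_Cons)
  have 1: "map (\<lambda>j. j \<in> Tset xs) [1..<dd xs] = steps xs" if "\<forall>x\<in>set xs. 1 \<le> x" "xs \<noteq> []" for xs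
    using that
  proof (induction xs rule: steps.induct)
    case (2 x)
    then show ?case by (auto simp: Tset_Cons Tset_Nil dd_def map_replicate_const[symmetric] intro!: nth_equalityI)
  next
    case (3 x y ys)
    have x: "1 \<le> x" "1 \<le> dd (y # ys)" using 3 by (auto simp: dd_def)
    have IH: "map (\<lambda>j. j \<in> Tset (y # ys)) [1..<dd (y # ys)] = steps (y # ys)"
      by (rule 3(1)) (use 3 in auto)
    have u: "[1..<x + dd (y # ys)] = [1..<x] @ x # [x + 1..<x + dd (y # ys)]"
      using x upt_add_eq_append[of 1 x "dd (y # ys)"] by (simp add: upt_conv_Cons)
    have d: "dd (x # y # ys) = x + dd (y # ys)" by (simp add: dd_def)
    have r: "map (\<lambda>j. j \<in> Tset (x # y # ys)) [1..<x] = replicate (x - 1) False"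
      by (rule nth_equalityI) (auto simp: Tset_Cons[of x])
    have "x \<in> Tset (x # y # ys)" by (simp add: Tset_Cons)
    then show ?case unfolding d u map_append list.map tail IH r by simp
  qed auto
  show "map (\<lambda>j. j \<in> Tset xs) [1..<dd xs] = steps xs" by (rule 1[OF assms])
  show "map (\<lambda>j. j \<in> Tset xs) [hd xs + 1..<dd xs] = steps (tl xs)" if "tl xs \<noteq> []"
  proof (cases xs)
    case (Cons x ys)
    then have "dd xs = x + dd ys" by (simp add: dd_def)
    then show ?thesis using tail[of x ys] 1[of ys] Cons that assms by auto
  qed (use assms in auto)
qed

lemma slope_replicate: "slope (replicate k False @ ts) = (fst (slope ts) + k * snd (slope ts), snd (slope ts))"
  by (induction k) auto

text \<open>False adds 1 to the ratio r of the slope pair and True sends r to 1 + 1/r. So True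
  preceded by x - 1 letters False gives x + 1/r, and a final block of x - 1 letters False raises the
  initial ratio 1 to x.\<close>

lemma cfval_steps:
  assumes "\<forall>x\<in>set xs. 1 \<le> x" "xs \<noteq> []"
  shows "cfval xs = of_nat (fst (slope (steps xs))) / of_nat (snd (slope (steps xs)))"
  using assms
proof (induction xs rule: steps.induct)
  case (2 x)
  then show ?case using slope_replicate[of "x - 1" "[]"] by (simp add: of_nat_diff)
next
  case (3 x y ys)
  define \<alpha> \<beta> where slope: "\<alpha> = fst (slope (steps (y # ys)))" "\<beta> = snd (slope (steps (y # ys)))"
  have pos: "\<alpha> > 0" "\<beta> > 0" unfolding slope by (rule slope_pos)+
  have "cfval (x # y # ys) = of_nat x + of_nat \<beta> / of_nat \<alpha>"
    using 3 by (simp add: slope)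
  moreover have "slope (steps (x # y # ys)) = (\<beta> + x * \<alpha>, \<alpha>)"
  proof -
    obtain k where "x = Suc k" using 3 by (cases x) auto
    then show ?thesis by (simp add: slope_replicate slope)
  qed
  ultimately show ?case using pos by (simp add: field_simps)
qed auto

text \<open>Each step adds one entry to the other, which is Euclid's algorithm run backwards. The
  ratio therefore determines the pair.\<close>

lemma coprime_slope: "coprime (fst (slope ts)) (snd (slope ts))"
proof (induction ts)
  case (Cons t ts)
  have "gcd (x + y) y = gcd x y" "gcd (x + y) x = gcd x y" for x y :: nat
    using gcd_add1[of x y] gcd_add1[of y x] by (simp_all add: add.commute gcd.commute)
  then show ?case using Cons by (simp add: coprime_iff_gcd_eq_1)
qed simp

lemma coprime_ratio:
  fixes a b c d :: nat
  assumes "coprime a b" "coprime c d" "a * d = c * b"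
  shows "a = c" "b = d"
proof -
  have "a dvd c * b" "c dvd a * d" using assms(3) by (metis dvd_triv_left)+
  then have "a dvd c" "c dvd a" using assms(1,2) by (auto simp: coprime_dvd_mult_left_iff)
  then show "a = c" by (rule dvd_antisym)
  have "b dvd a * d" "d dvd c * b" using assms(3) by (metis dvd_triv_right)+
  then have "b dvd d" "d dvd b" using assms(1,2) by (auto simp: coprime_dvd_mult_right_iff coprime_commute)
  then show "b = d" by (rule dvd_antisym)
qed

section \<open>The matrix C, its quadratic form and the binomials\<close>

lemma sum_delta_mult:
  assumes "finite A"
  shows "(\<Sum>k\<in>A. delta x k * f k) = (if x \<in> A then f x else 0)"
  using assms by (simp add: delta_def if_distrib[of "\<lambda>x. x * _"] cong: if_cong)

text \<open>Ordinary rows are -1, 2, -1 as in a Cartan matrix of type A, the rows in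
  \<open>Tset\<close> are -1, 1, 1; neighbours outside the window c+1..d are cut off.\<close>

lemma Cmat_row:
  assumes "j \<in> {c + 1..d}"
  shows "(\<Sum>k\<in>{c + 1..d}. Cmat as j k * int (m k)) =
    (if j \<in> Tset as then int (m j) + (if j < d then int (m (j + 1)) else 0) else 2 * int (m j) - (if j < d then int (m (j + 1)) else 0))
     - (if c + 1 < j then int (m (j - 1)) else 0)"
proof -
  let ?f = "\<lambda>k. int (m k)"
  let ?t = "if j \<in> Tset as then 1 else 2 :: int" and ?s = "if j \<in> Tset as then 1 else - 1 :: int"
  have "Cmat as j k * ?f k = ?t * (delta j k * ?f k) + ?s * (delta (j + 1) k * ?f k) - delta (j - 1) k * ?f k" for k
    using assms by (auto simp: Cmat_def Imat_def delta_def)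
  then have "(\<Sum>k\<in>{c + 1..d}. Cmat as j k * ?f k) = ?t * (\<Sum>k\<in>{c + 1..d}. delta j k * ?f k)
    + ?s * (\<Sum>k\<in>{c + 1..d}. delta (j + 1) k * ?f k) - (\<Sum>k\<in>{c + 1..d}. delta (j - 1) k * ?f k)"
    by (simp only: sum.distrib sum_subtractf sum_distrib_left)
  then show ?thesis using assms by (auto simp: sum_delta_mult)
qed

text \<open>Completing squares row by row telescopes. The squares are the exponents of the Burge
  steps; since \<open>mbar\<close> vanishes at d, the last row leaves m_d (m_(d-1) - m_d), the
  exponent in \<open>Wsum q []\<close>.\<close>

lemma quad_form:
  assumes "c + 2 \<le> d" "d = dd as"
  shows "(\<Sum>j\<in>{c + 1..d}. \<Sum>k\<in>{c + 1..d}. mbar as m j * Cmat as j k * int (m k))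
    = (int (m (c + 1)))\<^sup>2 + (\<Sum>j\<in>{c + 1..<d}. if j \<in> Tset as then (int (m (j + 1)))\<^sup>2 else (int (m j) - int (m (j + 1)))\<^sup>2)
      + int (m d) * (int (m (d - 1)) - int (m d))"
proof -
  let ?A = "\<lambda>j. int (m j) * ((if j \<in> Tset as then int (m j) + int (m (j + 1)) else 2 * int (m j) - int (m (j + 1)))
     - (if c + 1 < j then int (m (j - 1)) else 0))"
  let ?e = "\<lambda>j. if j \<in> Tset as then (int (m (j + 1)))\<^sup>2 else (int (m j) - int (m (j + 1)))\<^sup>2"
  have "(\<Sum>j\<in>{c + 1..d}. \<Sum>k\<in>{c + 1..d}. mbar as m j * Cmat as j k * int (m k))
    = (\<Sum>j\<in>{c + 1..d}. mbar as m j * (\<Sum>k\<in>{c + 1..d}. Cmat as j k * int (m k)))"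
    by (simp add: sum_distrib_left mult.assoc)
  also have "\<dots> = (\<Sum>j\<in>{c + 1..<d}. ?A j)"
  proof (rule sum.mono_neutral_cong_right)
    fix j assume j: "j \<in> {c + 1..<d}"
    then have "mbar as m j = int (m j)" "j \<in> {c + 1..d}" using assms by (auto simp: mbar_def)
    then show "mbar as m j * (\<Sum>k\<in>{c + 1..d}. Cmat as j k * int (m k)) = ?A j"
      using j by (simp only: Cmat_row) auto
  qed (use assms in \<open>auto simp: mbar_def\<close>)
  \<comment> \<open>For the induction the upper limit is freed; the unfinished square survives as
    -m_(n+1)^2 + m_n m_(n+1).\<close>
  also have "(\<Sum>j\<in>{c + 1..<n + 1}. ?A j) = (int (m (c + 1)))\<^sup>2 + (\<Sum>j\<in>{c + 1..<n + 1}. ?e j) - (int (m (n + 1)))\<^sup>2 + int (m n) * int (m (n + 1))"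
    if "c + 1 \<le> n" for n
    using that
  proof (induction n rule: dec_induct)
    case base
    have "{c + 1..<c + 1 + 1} = {c + 1}" by auto
    then show ?case by (simp only: sum.insert sum.empty finite.emptyI) (simp add: power2_eq_square algebra_simps)
  next
    case (step n)
    have "{c + 1..<Suc n + 1} = insert (Suc n) {c + 1..<n + 1}" "Suc n \<notin> {c + 1..<n + 1}" "c + 1 < Suc n"
      using step by auto
    then show ?case using step.IH by (cases "Suc n \<in> Tset as") (simp_all add: power2_eq_square algebra_simps)
  qed
  from this[of "d - 1"] have "(\<Sum>j\<in>{c + 1..<d}. ?A j) = (int (m (c + 1)))\<^sup>2 + (\<Sum>j\<in>{c + 1..<d}. ?e j) - (int (m d))\<^sup>2 + int (m (d - 1)) * int (m d)"
    using assms(1) by simp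
  finally show ?thesis by (simp add: power2_eq_square algebra_simps)
qed

text \<open>The common form of both summands: (s, c) = (0, 0) gives the first and (s, c) = (a_0, a_0) the second.\<close>

definition summand_gen :: "complex \<Rightarrow> nat list \<Rightarrow> nat \<Rightarrow> nat \<Rightarrow> (nat \<Rightarrow> nat) \<Rightarrow> (nat \<Rightarrow> nat) \<Rightarrow> complex" where
  "summand_gen q as s c n m = q powi ((\<Sum>i\<in>{1..s}. ((\<Sum>l\<in>{i..s}. int (n l)) + int (m (c + 1)))\<^sup>2)
      + (\<Sum>j\<in>{c + 1..dd as}. \<Sum>k\<in>{c + 1..dd as}. mbar as m j * Cmat as j k * int (m k)))
     / ((\<Prod>i\<in>{1..s}. qpoch q q (n i)) * qpoch q q (2 * m (c + 1)))
     * (\<Prod>j\<in>{c + 2..dd as}. qbinom q (tau as j * int (m j) + - (\<Sum>k\<in>{c + 1..dd as}. Cmat as j k * int (m k))) (tau as j * int (m j)))"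

lemma summand1_eq_gen: "summand1 q as m = summand_gen q as 0 0 (\<lambda>_. 0) m"
  by (simp add: summand1_def summand_gen_def quadC_def nvec1_def numeral_2_eq_2)

lemma summand2_eq_gen: "summand2 q as n m = summand_gen q as (hd as) (hd as) n m"
  by (simp add: summand2_def summand_gen_def expo2_def NN_def nvec2_def)

lemma qbinom_eq_gbinom_int: "qbinom q n m = gbinom_int q n m"
proof -
  have "qpoch q q = qfac q" by (simp add: fun_eq_iff qpoch_def qfac_def)
  then show ?thesis by (auto simp: qbinom_def gbinom_int_def gbinom_def nat_diff_distrib nat_mono)
qed

text \<open>These are the upper indices in \<open>Wsum\<close>. At j = d the value 1 of
  \<open>tau\<close> makes the binomial [m_(d-1); m_d], that of the starting identity.\<close>

lemma tau_plus_n: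
  assumes "c + 2 \<le> j" "j \<le> d" "d = dd as" "d \<in> Tset as"
  shows "tau as j * int (m j) + - (\<Sum>k\<in>{c + 1..d}. Cmat as j k * int (m k)) =
   (if j = d then int (m (d - 1)) else int (m (j - 1)) + (if j \<in> Tset as then int (m j) - int (m (j + 1)) else int (m (j + 1))))"
proof -
  have "j \<in> {c + 1..d}" using assms by auto
  then show ?thesis using assms by (subst Cmat_row) (auto simp: tau_def)
qed

text \<open>If no binomial vanishes, induction downwards from d shows that m decreases: the last one
  gives m_d <= m_(d-1), and an ordinary row gives 2 m_j <= m_(j-1) + m_(j+1) with m_(j+1) <= m_j
  already known; rows in \<open>Tset\<close> are similar.\<close>

lemma summand_gen_eq_0:
  assumes "c + 2 \<le> d" "d = dd as" "d \<in> Tset as" "i \<in> {c + 2..d}" "m (i - 1) < m i"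
  shows "summand_gen q as s c n m = 0"
proof (rule ccontr)
  assume "summand_gen q as s c n m \<noteq> 0"
  then have nz: "gbinom_int q (tau as j * int (m j) + - (\<Sum>k\<in>{c + 1..d}. Cmat as j k * int (m k))) (tau as j * int (m j)) \<noteq> 0"
    if "j \<in> {c + 2..d}" for j
    using that by (auto simp: summand_gen_def qbinom_eq_gbinom_int assms(2))
  have ge: "tau as j * int (m j) \<le> tau as j * int (m j) + - (\<Sum>k\<in>{c + 1..d}. Cmat as j k * int (m k))"
    if "j \<in> {c + 2..d}" for j
    using nz[OF that] gbinom_int_eq_0 by (metis not_less)
  have "m j \<le> m (j - 1)" if "j \<in> {c + 2..d}" for j
  proof -
    have "j \<le> d" "c + 2 \<le> j" using that by auto
    then show ?thesis
    proof (induction j rule: inc_induct)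
      case base
      then show ?case using ge[of d] tau_plus_n[of c d d as m] assms by (simp add: tau_def)
    next
      case (step j)
      then have "m (Suc j) \<le> m j" "tau as j = 2" using assms(2) by (auto simp: tau_def)
      moreover have "j \<in> {c + 2..d}" using step by auto
      ultimately show ?case using ge[of j] tau_plus_n[of c j d as m] assms step by (auto split: if_splits)
    qed
  qed
  then show False using assms(4,5) by (meson not_less)
qed

section \<open>Matching the summands with the weights\<close>

lemma Wweight_map:
  assumes "1 \<le> j" "j \<le> d"
  shows "Wweight q (map P [j..<d]) (m (j - 1)) (m j) (map m [j + 1..<d + 1])
   = q ^ (\<Sum>i\<in>{j..<d}. (if P i then m (i + 1) else m i - m (i + 1))\<^sup>2) * q ^ (m d * (m (d - 1) - m d))
    * (\<Prod>i\<in>{j..<d}. gbinom q (m (i - 1) + (if P i then m i - m (i + 1) else m (i + 1))) (2 * m i)) * gbinom q (m (d - 1)) (m d)"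
  using assms(2,1)
proof (induction j rule: inc_induct)
  case base
  then show ?case by simp
next
  case (step j)
  have 1: "[j..<d] = j # [Suc j..<d]" "[j + 1..<d + 1] = (j + 1) # [Suc j + 1..<d + 1]" "{j..<d} = insert j {Suc j..<d}"
    using step by (auto simp: upt_conv_Cons)
  have "Wweight q (map P [Suc j..<d]) (m j) (m (j + 1)) (map m [Suc j + 1..<d + 1]) =
    q ^ (\<Sum>i\<in>{Suc j..<d}. (if P i then m (i + 1) else m i - m (i + 1))\<^sup>2) * q ^ (m d * (m (d - 1) - m d))
    * (\<Prod>i\<in>{Suc j..<d}. gbinom q (m (i - 1) + (if P i then m i - m (i + 1) else m (i + 1))) (2 * m i)) * gbinom q (m (d - 1)) (m d)"
    using step.IH by simp
  then show ?case unfolding 1 list.map Wweight.simps by (simp add: power_add mult_ac)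
qed

lemma Vweight_map:
  assumes "i \<le> s" "s < N"
  shows "Vweight q (s - i) t ts (g i) (map g [i + 1..<N])
   = (\<Prod>k\<in>{i..<s}. q ^ (g (k + 1))\<^sup>2 / qfac q (g k - g (k + 1))) * Vweight q 0 t ts (g s) (map g [s + 1..<N])"
  using assms(1)
proof (induction i rule: inc_induct)
  case base
  then show ?case by simp
next
  case (step i)
  have 1: "[i + 1..<N] = (i + 1) # [Suc i + 1..<N]" "{i..<s} = insert i {Suc i..<s}" "s - i = Suc (s - Suc i)"
    using step assms by (auto simp: upt_conv_Cons)
  have IH: "Vweight q (s - Suc i) t ts (g (i + 1)) (map g [Suc i + 1..<N])
   = (\<Prod>k\<in>{Suc i..<s}. q ^ (g (k + 1))\<^sup>2 / qfac q (g k - g (k + 1))) * Vweight q 0 t ts (g s) (map g [s + 1..<N])"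
    using step.IH by simp
  show ?case unfolding 1 list.map Vweight.simps IH by (simp add: mult_ac)
qed

text \<open>The sequence N_1 + m, ..., N_s + m, m_(c+1), ..., m_d with m = m_(c+1), indexed from 0.\<close>

definition partial_sums :: "nat \<Rightarrow> nat \<Rightarrow> (nat \<Rightarrow> nat) \<Rightarrow> (nat \<Rightarrow> nat) \<Rightarrow> nat \<Rightarrow> nat" where
  "partial_sums s c n m i = (if i < s then (\<Sum>l\<in>{i + 1..s}. n l) + m (c + 1) else m (c + 1 + (i - s)))"

lemma partial_sums_step: "k < s \<Longrightarrow> partial_sums s c n m k = n (k + 1) + partial_sums s c n m (k + 1)"
proof -
  assume k: "k < s"
  then have "{k + 1..s} = insert (k + 1) {k + 2..s}" by auto
  then show ?thesis
  proof (cases "k + 1 < s")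
    case False
    then have "s = Suc k" using k by simp
    then show ?thesis by (simp add: partial_sums_def)
  qed (use k in \<open>auto simp: partial_sums_def\<close>)
qed

text \<open>Monotonicity of m makes every integer difference nonnegative, so the exponents and
  binomials of the statement agree with the natural-number expressions in the weights.\<close>

lemma summand_gen_eq:
  assumes d: "c + 2 \<le> d" "d = dd as" "d \<in> Tset as"
    and anti: "\<And>j. j \<in> {c + 2..d} \<Longrightarrow> m j \<le> m (j - 1)"
    and ts: "map (\<lambda>j. j \<in> Tset as) [c + 1..<d] = t # ts"
  shows "summand_gen q as s c n m = q ^ (partial_sums s c n m 0)\<^sup>2 * Vweight q s t ts (partial_sums s c n m 0) (map (partial_sums s c n m) [1..<s + (d - c)])"
proof -
  let ?g = "partial_sums s c n m" and ?P = "\<lambda>j. j \<in> Tset as"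
  let ?E = "\<lambda>i. (if ?P i then m (i + 1) else m i - m (i + 1))\<^sup>2"
  have anti': "m (j + 1) \<le> m j" if "j \<in> {c + 1..<d}" for j
    using anti[of "j + 1"] that by auto
  have qfac: "qpoch q q = qfac q" by (simp add: fun_eq_iff qpoch_def qfac_def)
  have "[c + 1..<d] = (c + 1) # [c + 2..<d]" using d by (simp add: upt_conv_Cons)
  then have tts: "t = ?P (c + 1)" "ts = map ?P [c + 2..<d]" using ts by auto
  have l1: "map ?g [s + 1..<s + (d - c)] = map m [c + 2..<d + 1]"
  proof -
    have "map ?g [s + 1..<s + (d - c)] = map (\<lambda>i. ?g (s + i)) [1..<d - c]" by (rule map_upt_shift)
    also have "\<dots> = map (\<lambda>i. m ((c + 1) + i)) [1..<d - c]" by (simp add: partial_sums_def)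
    also have "\<dots> = map m [(c + 1) + 1..<(c + 1) + (d - c)]" by (rule map_upt_shift[symmetric])
    finally show ?thesis using d by simp
  qed
  have l2: "map m [c + 2..<d + 1] = m (c + 2) # map m [c + 2 + 1..<d + 1]"
    using d by (simp add: upt_conv_Cons del: upt_Suc)
  let ?R = "\<Prod>i\<in>{c + 2..<d}. gbinom q (m (i - 1) + (if ?P i then m i - m (i + 1) else m (i + 1))) (2 * m i)"
  have v0: "Vweight q 0 t ts (?g s) (map ?g [s + 1..<s + (d - c)])
     = 1 / qfac q (2 * m (c + 1)) * q ^ (\<Sum>i\<in>{c + 1..<d}. ?E i) * q ^ (m d * (m (d - 1) - m d)) * ?R * gbinom q (m (d - 1)) (m d)"
  proof -
    have "Wweight q ts (m (c + 1)) (m (c + 2)) (map m [c + 2 + 1..<d + 1]) = q ^ (\<Sum>i\<in>{c + 2..<d}. ?E i) * q ^ (m d * (m (d - 1) - m d)) * ?R * gbinom q (m (d - 1)) (m d)"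
      using Wweight_map[of "c + 2" d q ?P m] d tts by simp
    moreover have "{c + 1..<d} = insert (c + 1) {c + 2..<d}" using d by auto
    moreover have "?g s = m (c + 1)" by (simp add: partial_sums_def)
    ultimately show ?thesis unfolding l1 l2 by (simp add: tts(1) power_add mult_ac)
  qed
  have v: "Vweight q s t ts (?g 0) (map ?g [1..<s + (d - c)])
    = (\<Prod>k\<in>{0..<s}. q ^ (?g (k + 1))\<^sup>2 / qfac q (n (k + 1))) * Vweight q 0 t ts (?g s) (map ?g [s + 1..<s + (d - c)])"
  proof -
    have "?g k - ?g (k + 1) = n (k + 1)" if "k < s" for k using partial_sums_step[OF that] by simp
    then show ?thesis using Vweight_map[of 0 s "s + (d - c)" q t ts ?g] d by simp
  qed
  have pr: "(\<Prod>k\<in>{0..<s}. q ^ (?g (k + 1))\<^sup>2 / qfac q (n (k + 1))) = q ^ (\<Sum>k\<in>{0..<s}. (?g (k + 1))\<^sup>2) / (\<Prod>i\<in>{1..s}. qfac q (n i))"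
  proof -
    have "(\<Prod>i\<in>{1..s}. qfac q (n i)) = (\<Prod>k\<in>{0..<s}. qfac q (n (k + 1)))"
      by (rule prod.reindex_bij_witness[of _ "\<lambda>k. k + 1" "\<lambda>i. i - 1"]) auto
    then show ?thesis by (simp add: prod_dividef power_sum)
  qed
  \<comment> \<open>The leading square of the outermost sum and the squares of the Bailey steps,
    shifted by one place, are the squares (N_i + m_(c+1))^2 together with the m_(c+1)^2 that
    \<open>quad_form\<close> provides.\<close>
  have sq: "(?g 0)\<^sup>2 + (\<Sum>k\<in>{0..<s}. (?g (k + 1))\<^sup>2) = (\<Sum>k\<in>{0..<s}. (?g k)\<^sup>2) + (m (c + 1))\<^sup>2"
  proof -
    have "(?g 0)\<^sup>2 + (\<Sum>k\<in>{0..<s}. (?g (k + 1))\<^sup>2) = (\<Sum>k\<in>{0..<Suc s}. (?g k)\<^sup>2)"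
      by (subst sum.atLeast0_lessThan_Suc_shift) simp
    then show ?thesis by (simp add: partial_sums_def[of _ _ _ _ s])
  qed
  have e1: "(\<Sum>i\<in>{1..s}. ((\<Sum>l\<in>{i..s}. int (n l)) + int (m (c + 1)))\<^sup>2) = int (\<Sum>k\<in>{0..<s}. (?g k)\<^sup>2)"
  proof -
    have "(\<Sum>i\<in>{1..s}. ((\<Sum>l\<in>{i..s}. int (n l)) + int (m (c + 1)))\<^sup>2) = (\<Sum>k\<in>{0..<s}. (int (?g k))\<^sup>2)"
      by (rule sum.reindex_bij_witness[of _ "\<lambda>k. k + 1" "\<lambda>i. i - 1"]) (auto simp: partial_sums_def)
    then show ?thesis by simp
  qed
  have e2: "(\<Sum>j\<in>{c + 1..d}. \<Sum>k\<in>{c + 1..d}. mbar as m j * Cmat as j k * int (m k))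
     = int ((m (c + 1))\<^sup>2 + (\<Sum>i\<in>{c + 1..<d}. ?E i) + m d * (m (d - 1) - m d))"
  proof -
    have "m d \<le> m (d - 1)" using anti[of d] d by auto
    moreover have "(if ?P j then (int (m (j + 1)))\<^sup>2 else (int (m j) - int (m (j + 1)))\<^sup>2) = int (?E j)" if "j \<in> {c + 1..<d}" for j
      using anti'[OF that] by (simp add: of_nat_diff)
    ultimately show ?thesis unfolding quad_form[OF d(1,2)] by (simp add: of_nat_diff)
  qed
  have b: "(\<Prod>j\<in>{c + 2..d}. qbinom q (tau as j * int (m j) + - (\<Sum>k\<in>{c + 1..d}. Cmat as j k * int (m k))) (tau as j * int (m j)))
    = ?R * gbinom q (m (d - 1)) (m d)"
  proof -
    have "qbinom q (tau as j * int (m j) + - (\<Sum>k\<in>{c + 1..d}. Cmat as j k * int (m k))) (tau as j * int (m j))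
      = gbinom q (m (j - 1) + (if ?P j then m j - m (j + 1) else m (j + 1))) (2 * m j)" if "j \<in> {c + 2..<d}" for j
    proof -
      have "c + 2 \<le> j" "j \<le> d" "j \<noteq> d" "tau as j = 2" using that d(2) by (auto simp: tau_def)
      moreover have "m (j + 1) \<le> m j" using anti'[of j] that by auto
      ultimately show ?thesis unfolding tau_plus_n[OF \<open>c + 2 \<le> j\<close> \<open>j \<le> d\<close> d(2,3)] qbinom_eq_gbinom_int gbinom_int_of_nat[symmetric]
        by (auto simp: of_nat_diff)
    qed
    moreover have "qbinom q (tau as d * int (m d) + - (\<Sum>k\<in>{c + 1..d}. Cmat as d k * int (m k))) (tau as d * int (m d)) = gbinom q (m (d - 1)) (m d)"
      unfolding tau_plus_n[OF d(1) order_refl d(2,3)] qbinom_eq_gbinom_int gbinom_int_of_nat[symmetric] using d(2) by (simp add: tau_def)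
    moreover have "{c + 2..d} = insert d {c + 2..<d}" using d by auto
    ultimately show ?thesis by (simp add: mult.commute)
  qed
  have "summand_gen q as s c n m = q ^ ((\<Sum>k\<in>{0..<s}. (?g k)\<^sup>2) + (m (c + 1))\<^sup>2 + (\<Sum>i\<in>{c + 1..<d}. ?E i) + m d * (m (d - 1) - m d))
    / ((\<Prod>i\<in>{1..s}. qfac q (n i)) * qfac q (2 * m (c + 1))) * (?R * gbinom q (m (d - 1)) (m d))"
    unfolding summand_gen_def d(2)[symmetric] e1 e2 b qfac of_nat_add[symmetric] power_int_of_nat by (simp only: add.assoc)
  also have "\<dots> = q ^ (?g 0)\<^sup>2 * Vweight q s t ts (?g 0) (map ?g [1..<s + (d - c)])"
    unfolding v pr v0 sq[symmetric] by (simp add: power_add)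
  finally show ?thesis .
qed

section \<open>Index tuples as decreasing sequences\<close>

lemma descents_iff: "zs \<in> descents n y \<longleftrightarrow> length zs = n \<and> (\<forall>i<n. (y # zs) ! Suc i \<le> (y # zs) ! i)"
proof (induction n arbitrary: y zs)
  case (Suc n)
  show ?case
  proof (cases zs)
    case (Cons z zs')
    then have "zs \<in> descents (Suc n) y \<longleftrightarrow> z \<le> y \<and> zs' \<in> descents n z" by auto
    also have "\<dots> \<longleftrightarrow> length zs = Suc n \<and> (\<forall>i<Suc n. (y # zs) ! Suc i \<le> (y # zs) ! i)"
      unfolding Suc.IH Cons by (auto simp: less_Suc_eq_0_disj)
    finally show ?thesis .
  qed auto
qed auto

definition supp_pairs :: "nat \<Rightarrow> nat \<Rightarrow> nat \<Rightarrow> ((nat \<Rightarrow> nat) \<times> (nat \<Rightarrow> nat)) set" where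
  "supp_pairs s c d = {(n, m). (\<forall>i. i \<notin> {1..s} \<longrightarrow> n i = 0) \<and> (\<forall>j. j \<notin> {c + 1..d} \<longrightarrow> m j = 0)}"

text \<open>A change of variables: (n, m) corresponds to a decreasing sequence of length s + (d -
  c), whose head is the unbounded index y and whose tail lies in \<open>descents\<close>.\<close>

lemma has_sum_descents:
  fixes h :: "nat \<times> nat list \<Rightarrow> complex"
  assumes d: "c + 2 \<le> d"
  shows "((\<lambda>(n, m). h (partial_sums s c n m 0, map (partial_sums s c n m) [1..<s + (d - c)])) has_sum S)
      {(n, m) \<in> supp_pairs s c d. \<forall>j\<in>{c + 2..d}. m j \<le> m (j - 1)}
    \<longleftrightarrow> (h has_sum S) (Sigma UNIV (descents (s + (d - c) - 1)))"
proof -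
  define N where "N = s + (d - c)"
  have N: "N \<ge> 2" "N = Suc (N - 1)" "s < N" using d by (auto simp: N_def)
  let ?J = "\<lambda>(n, m). (partial_sums s c n m 0, map (partial_sums s c n m) [1..<N])"
  \<comment> \<open>The inverse map: the first s differences of the list are the n_i, and the
    entries from position s on are m_(c+1), ..., m_d.\<close>
  let ?n = "\<lambda>l i. if i \<in> {1..s} then l ! (i - 1) - l ! i else (0::nat)"
  let ?m = "\<lambda>l j. if j \<in> {c + 1..d} then l ! (s + (j - (c + 1))) else (0::nat)"
  let ?I = "\<lambda>(y, zs). (?n (y # zs), ?m (y # zs))"
  have J: "partial_sums s c n m 0 # map (partial_sums s c n m) [1..<N] = map (partial_sums s c n m) [0..<N]" for n m
    using N by (simp add: upt_conv_Cons)
  \<comment> \<open>Summing the differences restores the list; truncated subtraction is exact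
    because the list decreases.\<close>
  have G: "partial_sums s c (?n l) (?m l) k = l ! k" if l: "length l = N" "\<And>i. i < N - 1 \<Longrightarrow> l ! Suc i \<le> l ! i" and k: "k < N" for l k
  proof (cases "k < s")
    case False
    then show ?thesis using k by (auto simp: partial_sums_def N_def)
  next
    case True
    then have "k \<le> s" by simp
    then show ?thesis
    proof (induction k rule: inc_induct)
      case base
      then show ?case using d by (simp add: partial_sums_def)
    next
      case (step k)
      have "l ! Suc k \<le> l ! k" using step N l(2)[of k] by simp
      moreover have "?n l (k + 1) = l ! k - l ! Suc k" using step by simp
      ultimately show ?case using partial_sums_step[OF \<open>k < s\<close>, of c "?n l" "?m l"] step.IH by simp
    qed
  qed
  show ?thesis unfolding N_def[symmetric]
  proof (rule has_sum_reindex_bij_witness[where i = ?I and j = ?J])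
    fix a assume "a \<in> {(n, m) \<in> supp_pairs s c d. \<forall>j\<in>{c + 2..d}. m j \<le> m (j - 1)}"
    then obtain n m where a: "a = (n, m)" and S: "\<And>i. i \<notin> {1..s} \<Longrightarrow> n i = 0" "\<And>j. j \<notin> {c + 1..d} \<Longrightarrow> m j = 0"
      and anti: "\<And>j. j \<in> {c + 2..d} \<Longrightarrow> m j \<le> m (j - 1)"
      unfolding supp_pairs_def by auto
    let ?g = "partial_sums s c n m"
    have nth: "map ?g [0..<N] ! k = ?g k" if "k < N" for k using that by simp
    show "?I (?J a) = a"
    proof -
      have "?n (map ?g [0..<N]) i = n i" for i
      proof (cases "i \<in> {1..s}")
        case True
        then obtain k where "i = k + 1" "k < s" by (cases i) auto
        then show ?thesis using partial_sums_step[of k s c n m] N by simp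
      qed (use S in auto)
      moreover have "?m (map ?g [0..<N]) j = m j" for j
      proof (cases "j \<in> {c + 1..d}")
        case True
        then obtain i where "j = c + 1 + i" "i < d - c" by (auto simp: le_iff_add)
        then show ?thesis using d by (simp add: partial_sums_def N_def)
      qed (use S in auto)
      ultimately show ?thesis unfolding a by (simp only: prod.case J)
    qed
    show "?J a \<in> Sigma UNIV (descents (N - 1))"
    proof -
      have "?g (Suc i) \<le> ?g i" if "i < N - 1" for i
      proof (cases "i < s")
        case True
        then show ?thesis using partial_sums_step[of i s c n m] by simp
      next
        case False
        then have "c + 1 + (Suc i - s) \<in> {c + 2..d}" "c + 1 + (Suc i - s) - 1 = c + 1 + (i - s)" using that by (auto simp: N_def)
        from anti[OF this(1)] this(2) show ?thesis using False by (simp add: partial_sums_def)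
      qed
      moreover have "map ?g [0..<N] ! Suc i = ?g (Suc i)" "map ?g [0..<N] ! i = ?g i" if "i < N - 1" for i
        using that by auto
      ultimately show ?thesis unfolding a by (simp only: prod.case mem_Sigma_iff UNIV_I descents_iff J) auto
    qed
    show "h (?J a) = (case a of (n, m) \<Rightarrow> h (partial_sums s c n m 0, map (partial_sums s c n m) [1..<N]))"
      unfolding a by simp
  next
    fix b assume "b \<in> Sigma UNIV (descents (N - 1))"
    then obtain y zs where b: "b = (y, zs)" and l: "length (y # zs) = N" "\<And>i. i < N - 1 \<Longrightarrow> (y # zs) ! Suc i \<le> (y # zs) ! i"
      using N by (auto simp: descents_iff)
    let ?l = "y # zs"
    have "map (partial_sums s c (?n ?l) (?m ?l)) [0..<N] = ?l"
      by (rule nth_equalityI) (use l(1) G[OF l] in \<open>auto simp del: nth_Cons_Suc\<close>)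
    then show "?J (?I b) = b" unfolding b prod.case J[symmetric] by simp
    have mono: "?m ?l j \<le> ?m ?l (j - 1)" if "j \<in> {c + 2..d}" for j
    proof -
      have "s + (j - (c + 1)) = Suc (s + (j - 1 - (c + 1)))" "s + (j - 1 - (c + 1)) < N - 1"
        using that by (auto simp: N_def)
      then show ?thesis using that l(2)[of "s + (j - 1 - (c + 1))"] by auto
    qed
    have mem: "(n, m) \<in> {(n, m) \<in> supp_pairs s c d. \<forall>j\<in>{c + 2..d}. m j \<le> m (j - 1)}"
      if "\<And>i. i \<notin> {1..s} \<Longrightarrow> n i = 0" "\<And>j. j \<notin> {c + 1..d} \<Longrightarrow> m j = 0" "\<And>j. j \<in> {c + 2..d} \<Longrightarrow> m j \<le> m (j - 1)" for n m
      using that by (auto simp: supp_pairs_def)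
    show "?I b \<in> {(n, m) \<in> supp_pairs s c d. \<forall>j\<in>{c + 2..d}. m j \<le> m (j - 1)}"
      unfolding b prod.case by (rule mem) (simp_all only: if_False mono)
  qed simp
qed

lemma has_sum_summand_gen:
  assumes q: "norm q < 1" and d: "c + 2 \<le> d" "d = dd as" "d \<in> Tset as"
    and ts: "map (\<lambda>j. j \<in> Tset as) [c + 1..<d] = t # ts"
  shows "((\<lambda>(n, m). summand_gen q as s c n m) has_sum (theta q (theta_index (Suc s) t ts) / qprod q q)) (supp_pairs s c d)"
proof -
  let ?h = "\<lambda>(y, zs). q ^ y\<^sup>2 * Vweight q s t ts y zs"
  let ?A = "{(n, m) \<in> supp_pairs s c d. \<forall>j\<in>{c + 2..d}. m j \<le> m (j - 1)}"
  have "length ts = d - c - 2" using arg_cong[OF ts, of length] by simp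
  then have len: "s + Suc (length ts) = s + (d - c) - 1" using d by simp
  have "((\<lambda>(n, m). ?h (partial_sums s c n m 0, map (partial_sums s c n m) [1..<s + (d - c)])) has_sum (theta q (theta_index (Suc s) t ts) / qprod q q)) ?A"
    unfolding has_sum_descents[OF d(1)] len[symmetric] by (rule has_sum_Vweight[OF q])
  moreover have "((\<lambda>(n, m). summand_gen q as s c n m) has_sum x) (supp_pairs s c d) \<longleftrightarrow>
      ((\<lambda>(n, m). ?h (partial_sums s c n m 0, map (partial_sums s c n m) [1..<s + (d - c)])) has_sum x) ?A" for x
  proof (rule has_sum_cong_neutral)
    fix p assume p: "p \<in> supp_pairs s c d - ?A"
    obtain n m where nm: "p = (n, m)" by (cases p)
    with p have "\<exists>j\<in>{c + 2..d}. m (j - 1) < m j" by (auto simp: not_le)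
    with nm show "(case p of (n, m) \<Rightarrow> summand_gen q as s c n m) = 0"
      using summand_gen_eq_0[OF d] by auto
  next
    fix p assume p: "p \<in> supp_pairs s c d \<inter> ?A"
    then obtain n m where "p = (n, m)" "\<And>j. j \<in> {c + 2..d} \<Longrightarrow> m j \<le> m (j - 1)" by auto
    then show "(case p of (n, m) \<Rightarrow> summand_gen q as s c n m) = (case p of (n, m) \<Rightarrow> ?h (partial_sums s c n m 0, map (partial_sums s c n m) [1..<s + (d - c)]))"
      using summand_gen_eq[OF d _ ts] by simp
  qed auto
  ultimately show ?thesis by simp
qed

section \<open>The two cases of the theorem\<close>

lemma theta_rhs:
  assumes "norm q < 1" "a * b > 1"
  shows "theta q (a * b - 1) / qprod q q = rhs q a b"
  using Jacobi_triple_product[OF assms] by (simp add: rhs_def qprod_def qpoch_inf_def mult.assoc)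

theorem theorem3p11:
  fixes q :: complex and a b :: nat and as :: "nat list"
  assumes "norm q < 1"
    and "coprime a b" and "1 \<le> b" and "b < a" and "a \<noteq> 2 * b"
    and "is_cf_expansion a b as"
  shows "(a < 2 * b \<longrightarrow>
            (summand1 q as has_sum rhs q a b)
              {m :: nat \<Rightarrow> nat. \<forall>j. j \<notin> {1..dd as} \<longrightarrow> m j = 0})
       \<and> (a > 2 * b \<and> b \<noteq> 1 \<longrightarrow>
            ((\<lambda>(n, m). summand2 q as n m) has_sum rhs q a b)
              {(n :: nat \<Rightarrow> nat, m :: nat \<Rightarrow> nat).
                 (\<forall>i. i \<notin> {1..hd as} \<longrightarrow> n i = 0)
               \<and> (\<forall>j. j \<notin> {hd as + 1..dd as} \<longrightarrow> m j = 0)})"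
proof (intro conjI impI)
  note q = assms(1)
  have as: "as \<noteq> []" "\<forall>x\<in>set as. 1 \<le> x" "2 \<le> last as" "cfval as = cf a b"
    using assms(6) by (auto simp: is_cf_expansion_def)
  have dT: "dd as \<in> Tset as"
    using as(1) by (auto simp: Tset_def tt_def dd_def Suc_le_eq intro!: exI[of _ "length as"])
  have ab1: "a * b > 1"
  proof -
    have "2 * 1 \<le> a * b" using assms(3,4) by (intro mult_le_mono) auto
    then show ?thesis by simp
  qed
  {
    assume slope: "a < 2 * b"
    \<comment> \<open>The condition that the last quotient is at least 2 guarantees a first letter
      \<open>t\<close>.\<close>
    have "2 \<le> dd as"
      using member_le_sum_list[of "last as" as] as by (simp add: dd_def)
    moreover from this obtain t ts where ts: "map (\<lambda>j. j \<in> Tset as) [0 + 1..<dd as] = t # ts"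
      by (simp add: upt_conv_Cons)
    ultimately have H: "((\<lambda>(n, m). summand_gen q as 0 0 n m) has_sum (theta q (theta_index (Suc 0) t ts) / qprod q q)) (supp_pairs 0 0 (dd as))"
      by (intro has_sum_summand_gen q dT refl) auto
    define \<alpha> \<beta> where \<alpha>\<beta>: "\<alpha> = fst (slope (t # ts))" "\<beta> = snd (slope (t # ts))"
    have st: "t # ts = steps as"
      using ts map_Tset_eq_steps(1)[OF as(2,1)] by simp
    have pos: "\<alpha> > 0" "\<beta> > 0" unfolding \<alpha>\<beta> by (rule slope_pos)+
    have "(of_nat \<alpha> / of_nat \<beta> :: rat) = inverse (of_nat a / of_nat b - 1)"
      using cfval_steps[OF as(2,1)] as(4) slope unfolding st[symmetric] \<alpha>\<beta> cf_def by simp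
    also have "\<dots> = of_nat b / of_nat (a - b)"
      using assms(3,4) by (simp add: of_nat_diff field_simps)
    finally have "(of_nat (\<alpha> * (a - b)) :: rat) = of_nat (b * \<beta>)"
      using pos assms(3,4) by (simp add: field_simps)
    then have "\<alpha> * (a - b) = b * \<beta>" by (simp only: of_nat_eq_iff)
    moreover have "coprime \<alpha> \<beta>" unfolding \<alpha>\<beta> by (rule coprime_slope)
    moreover have "coprime b (a - b)"
    proof -
      obtain k where "a = k + b" using assms(4) less_imp_add_positive by (metis add.commute)
      moreover from this have "gcd b k = 1"
        using assms(2) gcd_add1[of k b] unfolding coprime_iff_gcd_eq_1 by (simp only: gcd.commute[of b])
      ultimately show ?thesis by (simp add: coprime_iff_gcd_eq_1)
    qed
    ultimately have e: "\<alpha> = b" "\<beta> = a - b" using coprime_ratio by blast+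
    \<comment> \<open>Here \<alpha> \<beta> + \<alpha>^2 = b (a - b) + b^2 = a b; the one added
      square comes from the outermost infinite sum.\<close>
    have "theta_index (Suc 0) t ts = a * b - 1"
    proof -
      obtain k where "a = b + k" using assms(4) less_imp_add_positive by blast
      moreover have "\<alpha> * \<beta> > 0" using pos by simp
      ultimately show ?thesis using e unfolding theta_index_def \<alpha>\<beta>[symmetric] by (simp add: power2_eq_square algebra_simps)
    qed
    with H have H': "((\<lambda>(n, m). summand_gen q as 0 0 n m) has_sum rhs q a b) (supp_pairs 0 0 (dd as))"
      using theta_rhs[OF q ab1] by simp
    have "(summand1 q as has_sum rhs q a b) {m. \<forall>j. j \<notin> {1..dd as} \<longrightarrow> m j = 0}
      \<longleftrightarrow> ((\<lambda>(n, m). summand_gen q as 0 0 n m) has_sum rhs q a b) (supp_pairs 0 0 (dd as))"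
      by (rule has_sum_reindex_bij_witness[where i = snd and j = "\<lambda>m. (\<lambda>_. 0, m)"])
        (auto simp: supp_pairs_def summand1_eq_gen)
    with H' show "(summand1 q as has_sum rhs q a b) {m. \<forall>j. j \<notin> {1..dd as} \<longrightarrow> m j = 0}" by simp
  next
    assume slope: "2 * b < a \<and> b \<noteq> 1"
    obtain x xs where xs: "as = x # xs" using as(1) by (cases as) auto
    have cfv: "cfval as = of_nat a / of_nat b - 1" using as(4) slope by (simp add: cf_def)
    \<comment> \<open>With a single quotient a/b would be an integer, so coprimality would force b =
      1.\<close>
    have ne: "xs \<noteq> []"
    proof
      assume "xs = []"
      then have "(of_nat a :: rat) = of_nat ((x + 1) * b)"
        using cfv xs assms(3) by (simp add: field_simps)
      then have "a = (x + 1) * b" by (simp only: of_nat_eq_iff)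
      then have "b dvd a" by simp
      with assms(2) have "is_unit b" by (rule coprime_common_divisor) simp
      then show False using slope by simp
    qed
    have "last xs \<in> set xs" "2 \<le> last xs" using ne as(3) xs by auto
    then have "hd as + 2 \<le> dd as"
      using member_le_sum_list[of "last xs" xs] xs by (simp add: dd_def)
    moreover from this obtain t ts where ts: "map (\<lambda>j. j \<in> Tset as) [hd as + 1..<dd as] = t # ts"
      by (simp add: upt_conv_Cons)
    ultimately have H: "((\<lambda>(n, m). summand_gen q as (hd as) (hd as) n m) has_sum (theta q (theta_index (Suc x) t ts) / qprod q q)) (supp_pairs (hd as) (hd as) (dd as))"
      using has_sum_summand_gen[OF q _ refl dT ts, of "hd as"] xs by simp
    define \<alpha> \<beta> where \<alpha>\<beta>: "\<alpha> = fst (slope (t # ts))" "\<beta> = snd (slope (t # ts))"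
    have st: "t # ts = steps xs"
      using ts map_Tset_eq_steps(2)[OF as(2,1)] ne xs by simp
    have pos: "\<alpha> > 0" "\<beta> > 0" unfolding \<alpha>\<beta> by (rule slope_pos)+
    have "cfval xs = (of_nat \<alpha> / of_nat \<beta> :: rat)"
      using cfval_steps[of xs] as(2) ne xs unfolding st[symmetric] \<alpha>\<beta> by simp
    moreover have "cfval as = of_nat x + 1 / cfval xs" using ne xs by (cases xs) auto
    ultimately have "(of_nat a / of_nat b - 1 :: rat) = of_nat x + of_nat \<beta> / of_nat \<alpha>"
      using cfv by simp
    then have "(of_nat (a * \<alpha>) :: rat) = of_nat (b * ((x + 1) * \<alpha> + \<beta>))"
      using pos assms(3) by (simp add: field_simps)
    then have "a * \<alpha> = b * ((x + 1) * \<alpha> + \<beta>)" by (simp only: of_nat_eq_iff)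
    moreover have "coprime ((x + 1) * \<alpha> + \<beta>) \<alpha>"
      using coprime_slope[of "t # ts"] unfolding \<alpha>\<beta>[symmetric]
      by (simp add: coprime_iff_gcd_eq_1 gcd.commute) (metis add.commute gcd.commute gcd_add_mult mult.commute mult_Suc)
    ultimately have e: "a = (x + 1) * \<alpha> + \<beta>" "b = \<alpha>"
      using coprime_ratio[of a b "(x + 1) * \<alpha> + \<beta>" \<alpha>] assms(2) by (auto simp: mult.commute)
    \<comment> \<open>Here x = a_0 Bailey steps and the outermost infinite sum add \<alpha>^2 a
      total of a_0 + 1 times.\<close>
    have "theta_index (Suc x) t ts = a * b - 1"
    proof -
      have "\<alpha> * \<beta> > 0" using pos by simp
      moreover have "a * b = \<alpha> * \<beta> + Suc x * \<alpha>\<^sup>2"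
        unfolding e by (simp add: power2_eq_square algebra_simps)
      ultimately show ?thesis unfolding theta_index_def \<alpha>\<beta>[symmetric] by linarith
    qed
    with H show "((\<lambda>(n, m). summand2 q as n m) has_sum rhs q a b)
              {(n, m). (\<forall>i. i \<notin> {1..hd as} \<longrightarrow> n i = 0) \<and> (\<forall>j. j \<notin> {hd as + 1..dd as} \<longrightarrow> m j = 0)}"
      using theta_rhs[OF q ab1] by (simp add: summand2_eq_gen supp_pairs_def)
  }
qed

end
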